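(* Let $\Gamma$ be a finite group with $\mathrm{Irr}(\Gamma)=\{\chi_1,\dots,\chi_h\}$, and let $\mathrm{Cay}(\Gamma,S)$ be a normal mixed Cayley graph. Then the HS-spectrum of $\mathrm{Cay}(\Gamma,S)$ is $\{[\gamma_1]^{d_1^2},\dots,[\gamma_h]^{d_h^2}\}$, where for each $j\in\{1,\dots,h\}$, $d_j=\chi_j(\mathbf 1)$, $\gamma_j=\lambda_j+\mu_j$, $$\lambda_j=\frac{1}{\chi_j(\mathbf 1)}\sum_{s\in S\setminus\overline S}\chi_j(s),\qquad \mu_j=\frac{1}{\chi_j(\mathbf 1)}\sum_{s\in\overline S}\bigl(\omega_6\chi_j(s)+\omega_6^5\chi_j(s^{-1})\bigr).$$
   Context: Let $\Gamma$ be a finite group with identity $\mathbf 1$ and $S\subseteq\Gamma$ with $\mathbf 1\notin S$. The mixed Cayley graph $G=\mathrm{Cay}(\Gamma,S)$ has vertex set $\Gamma$ and edge set $E=\{(a,b): a,b\in\Gamma,\ ba^{-1}\in S\}$ (ordered pairs). It is normal if $S$ is a union of conjugacy classes of $\Gamma$. Put $\overline S=\{u\in S: u^{-1}\notin S\}$. $\mathrm{Irr}(\Gamma)$ is the set of irreducible complex characters of $\Gamma$, and $\omega_6=\exp(2\pi i/6)$. The Hermitian-adjacency matrix of the second kind $\mathcal H(G)=(h_{uv})$ has $h_{uv}=1$ if $(u,v),(v,u)\in E$; $h_{uv}=\frac{1+i\sqrt3}{2}$ if $(u,v)\in E$, $(v,u)\notin E$; $h_{uv}=\frac{1-i\sqrt3}{2}$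 if $(u,v)\notin E$, $(v,u)\in E$; and $h_{uv}=0$ otherwise. The HS-spectrum of $G$ is the multiset of eigenvalues of $\mathcal H(G)$. The notation $\{[\gamma_1]^{n_1},\dots,[\gamma_h]^{n_h}\}$ means the multiset in which each $\gamma_j$ is listed $n_j$ times (multiplicities add if some $\gamma_j$ coincide). *)

theory Defs
  imports
    "HOL-Algebra.Group_Action"
    "Jordan_Normal_Form.Char_Poly"
    "Jordan_Normal_Form.VS_Connect"
    "Graph_Theory.Pair_Digraph"
begin

definition GL_cplx :: "nat \<Rightarrow> complex mat monoid" where
  "GL_cplx n = units_of (ring_mat TYPE(complex) n ())"

definition mat_trace :: "complex mat \<Rightarrow> complex" where
  "mat_trace A = (\<Sum>i<dim_row A. A $$ (i, i))"

definition irreducible_rep ::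
    "('a, 'b) monoid_scheme \<Rightarrow> nat \<Rightarrow> ('a \<Rightarrow> complex mat) \<Rightarrow> bool" where
  "irreducible_rep G n \<rho> \<longleftrightarrow>
     n > 0 \<and> \<rho> \<in> hom G (GL_cplx n) \<and>
     (\<forall>W. VectorSpace.subspace class_ring W (module_vec TYPE(complex) n) \<and>
          (\<forall>g\<in>carrier G. \<forall>w\<in>W. \<rho> g *\<^sub>v w \<in> W)
          \<longrightarrow> W = {0\<^sub>v n} \<or> W = carrier_vec n)"

text \<open>Characters are restricted to the carrier, so that equality of functions is equality of
  characters and every character occurs exactly once in this set.\<close>
definition irr_chars :: "('a, 'b) monoid_scheme \<Rightarrow> ('a \<Rightarrow> complex) set" where
  "irr_chars G = {restrict (\<lambda>g. mat_trace (\<rho> g)) (carrier G) | n \<rho>. irreducible_rep G n \<rho>}"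

text \<open>The degree \<open>\<chi>(\<one>)\<close> of an irreducible character is a positive natural number.\<close>
lemma irr_chars_degree:
  assumes "group G" and "\<chi> \<in> irr_chars G"
  shows "\<exists>d>0. of_nat d = \<chi> \<one>\<^bsub>G\<^esub>"
proof -
  from assms(2) obtain n \<rho> where \<chi>: "\<chi> = restrict (\<lambda>g. mat_trace (\<rho> g)) (carrier G)"
    and irr: "irreducible_rep G n \<rho>"
    by (auto simp: irr_chars_def)
  interpret R: ring "ring_mat TYPE(complex) n ()" by (rule ring_mat)
  have "group (GL_cplx n)" unfolding GL_cplx_def by (rule R.units_group)
  moreover have "\<rho> \<in> hom G (GL_cplx n)" and n: "n > 0"
    using irr by (auto simp: irreducible_rep_def)
  ultimately have "\<rho> \<one>\<^bsub>G\<^esub> = \<one>\<^bsub>GL_cplx n\<^esub>"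
    using assms(1) by (intro hom_one)
  then have "\<rho> \<one>\<^bsub>G\<^esub> = 1\<^sub>m n"
    by (simp add: GL_cplx_def units_of_def ring_mat_simps)
  moreover have "\<one>\<^bsub>G\<^esub> \<in> carrier G"
    using assms(1) by (simp add: group.is_monoid)
  ultimately have "\<chi> \<one>\<^bsub>G\<^esub> = of_nat n"
    by (simp add: \<chi> mat_trace_def)
  with n show ?thesis by metis
qed

definition cayley_graph :: "('a, 'b) monoid_scheme \<Rightarrow> 'a set \<Rightarrow> 'a pair_pre_digraph" where
  "cayley_graph G S =
     \<lparr> pverts = carrier G,
       parcs = {(a, b). a \<in> carrier G \<and> b \<in> carrier G \<and> b \<otimes>\<^bsub>G\<^esub> inv\<^bsub>G\<^esub> a \<in> S} \<rparr>"

definition conj_classes :: "('a, 'b) monoid_scheme \<Rightarrow> 'a set set" where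
  "conj_classes G =
     orbits G (carrier G) (\<lambda>g. \<lambda>x\<in>carrier G. g \<otimes>\<^bsub>G\<^esub> x \<otimes>\<^bsub>G\<^esub> inv\<^bsub>G\<^esub> g)"

definition normal_connection_set :: "('a, 'b) monoid_scheme \<Rightarrow> 'a set \<Rightarrow> bool" where
  "normal_connection_set G S \<longleftrightarrow> (\<exists>\<C>\<subseteq>conj_classes G. S = \<Union>\<C>)"

definition sbar :: "('a, 'b) monoid_scheme \<Rightarrow> 'a set \<Rightarrow> 'a set" where
  "sbar G S = {u \<in> S. inv\<^bsub>G\<^esub> u \<notin> S}"

definition omega6 :: complex where
  "omega6 = exp (2 * of_real pi * \<i> / 6)"

definition hs_entry :: "'a pair_pre_digraph \<Rightarrow> 'a \<Rightarrow> 'a \<Rightarrow> complex" where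
  "hs_entry D u v =
     (if (u, v) \<in> parcs D \<and> (v, u) \<in> parcs D then 1
      else if (u, v) \<in> parcs D \<and> (v, u) \<notin> parcs D then (1 + \<i> * of_real (sqrt 3)) / 2
      else if (u, v) \<notin> parcs D \<and> (v, u) \<in> parcs D then (1 - \<i> * of_real (sqrt 3)) / 2
      else 0)"

text \<open>Matrices are indexed by natural numbers, so rows and columns follow a list \<open>vs\<close>
  enumerating the vertices without repetition.\<close>
definition hs_matrix :: "'a pair_pre_digraph \<Rightarrow> 'a list \<Rightarrow> complex mat" where
  "hs_matrix D vs = mat (length vs) (length vs) (\<lambda>(i, j). hs_entry D (vs ! i) (vs ! j))"

definition hs_spectrum :: "'a pair_pre_digraph \<Rightarrow> 'a list \<Rightarrow> complex multiset" where
  "hs_spectrum D vs = proots (char_poly (hs_matrix D vs))"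

end

theory Submission
  imports Defs "HOL-Computational_Algebra.Fundamental_Theorem_Algebra"
begin

text \<open>
  The matrix of the graph has entries \<open>f (y x\<^sup>-\<^sup>1)\<close> for a class function \<open>f\<close>. For an irreducible
  representation \<open>\<sigma>\<close> of degree \<open>d\<close>, Schur's lemma makes \<open>\<Sum>\<^sub>g f(g) \<sigma>(g)\<close> a scalar, so every matrix
  coefficient \<open>x \<mapsto> \<sigma>(x)\<^sub>a\<^sub>b\<close> is an eigenvector with eigenvalue \<open>(\<Sum>\<^sub>g f(g) \<chi>(g)) / d\<close>, which gives
  \<open>d\<^sup>2\<close> eigenvectors. Schur orthogonality provides a left inverse \<open>Q\<close> of the matrix \<open>P\<close> whose columns are
  the coefficients of representatives of all irreducible characters. The idempotent \<open>P Q\<close> is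
  convolution with \<open>|G|\<^sup>-\<^sup>1 \<Sum>\<^sub>\<chi> \<chi>(1) \<chi>\<close> and commutes with right translations. If it were not the identity,
  its kernel would contain an irreducible subrepresentation; but such a subrepresentation consists of
  matrix coefficients, which \<open>P Q\<close> fixes. Hence \<open>P\<close> is invertible and diagonalises the matrix.
\<close>

section \<open>Injective complex matrices and bases of subspaces\<close>

lemma mat_mult_entry:
  assumes "A \<in> carrier_mat m k" "B \<in> carrier_mat k n" "i < m" "j < n"
  shows "(A * B) $$ (i, j) = (\<Sum>l<k. A $$ (i, l) * B $$ (l, j))"
  using assms by (auto simp: scalar_prod_def atLeast0LessThan intro!: sum.cong)

lemma mat_trace_eq: "A \<in> carrier_mat n n \<Longrightarrow> mat_trace A = (\<Sum>i<n. A $$ (i, i))"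
  by (auto simp: mat_trace_def)

lemma mat_trace_mult_commute:
  assumes "A \<in> carrier_mat m n" "B \<in> carrier_mat n m"
  shows "mat_trace (A * B) = mat_trace (B * A)"
proof -
  have "mat_trace (A * B) = (\<Sum>i<m. \<Sum>l<n. A $$ (i, l) * B $$ (l, i))"
    using assms by (auto simp: mat_trace_def mat_mult_entry[of A m n B m] simp del: index_mult_mat(1) intro!: sum.cong)
  also have "\<dots> = (\<Sum>l<n. \<Sum>i<m. B $$ (l, i) * A $$ (i, l))"
    by (subst sum.swap) (simp add: mult.commute)
  also have "\<dots> = mat_trace (B * A)"
    using assms by (auto simp: mat_trace_def mat_mult_entry[of B n m A n] simp del: index_mult_mat(1) intro!: sum.cong)
  finally show ?thesis .
qed

text \<open>Lets kernels, images and ranges be tested against the subspace predicate of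
  \<open>irreducible_rep\<close> by plain closure conditions.\<close>

lemma subspace_module_vec_iff:
  "VectorSpace.subspace class_ring W (module_vec TYPE(complex) n) \<longleftrightarrow>
     W \<subseteq> carrier_vec n \<and> 0\<^sub>v n \<in> W \<and> (\<forall>v\<in>W. \<forall>w\<in>W. v + w \<in> W) \<and> (\<forall>c. \<forall>v\<in>W. c \<cdot>\<^sub>v v \<in> W)"
proof -
  interpret vec_space "TYPE(complex)" n .
  have vs: "vectorspace class_ring (module_vec TYPE(complex) n)" by unfold_locales
  have md: "module class_ring (module_vec TYPE(complex) n)" by unfold_locales
  show ?thesis
    using vs md
    by (auto simp: VectorSpace.subspace_def submodule_def module_vec_simps class_ring_simps)
qed

lemma kernel_subspace:
  assumes A: "A \<in> carrier_mat m n"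
  shows "VectorSpace.subspace class_ring {v \<in> carrier_vec n. A *\<^sub>v v = 0\<^sub>v m} (module_vec TYPE(complex) n)"
  unfolding subspace_module_vec_iff using A
  by (auto simp: mult_add_distrib_mat_vec[OF A] mult_mat_vec[OF A])

text \<open>Algebraic closedness of the complex numbers enters here: the characteristic polynomial
  has positive degree and therefore a root.\<close>

lemma complex_eigenvector_exists:
  fixes A :: "complex mat"
  assumes A: "A \<in> carrier_mat n n" and n: "n > 0"
  obtains c v where "v \<in> carrier_vec n" "v \<noteq> 0\<^sub>v n" "A *\<^sub>v v = c \<cdot>\<^sub>v v"
proof -
  have "degree (char_poly A) = n" using degree_monic_char_poly[OF A] by simp
  with n have "\<not> constant (poly (char_poly A))" by (simp add: constant_degree)
  then obtain c where "poly (char_poly A) c = 0" using fundamental_theorem_of_algebra by blast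
  then have "eigenvalue A c" using eigenvalue_root_char_poly[OF A] by simp
  then show ?thesis using that A unfolding eigenvalue_def eigenvector_def by auto
qed

lemma mat_mult_unit_vec:
  fixes A :: "'a::semiring_1 mat"
  assumes "A \<in> carrier_mat m n" "j < n"
  shows "A *\<^sub>v unit_vec n j = col A j"
  using assms by (intro eq_vecI) (auto simp: scalar_prod_right_unit)

lemma eq_matI_mult_vec:
  fixes A B :: "'a::comm_ring_1 mat"
  assumes "A \<in> carrier_mat m n" "B \<in> carrier_mat m n"
    and "\<And>v. v \<in> carrier_vec n \<Longrightarrow> A *\<^sub>v v = B *\<^sub>v v"
  shows "A = B"
proof (rule eq_matI)
  fix i j assume "i < dim_row B" "j < dim_col B"
  then have "col A j = col B j" and "i < m" "j < n" using assms mat_mult_unit_vec by (metis carrier_matD unit_vec_carrier)+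
  then show "A $$ (i, j) = B $$ (i, j)" using assms(1,2) by (metis carrier_matD index_col)
qed (use assms in auto)

text \<open>Solutions found column by column are assembled into one matrix. This supplies right
  inverses and the matrices of a restricted representation.\<close>

lemma mat_factorization_of_cols:
  assumes B: "B \<in> carrier_mat n l" and C: "C \<in> carrier_mat n k"
    and cols: "\<And>j. j < k \<Longrightarrow> \<exists>y\<in>carrier_vec l. B *\<^sub>v y = col C j"
  obtains X where "X \<in> carrier_mat l k" "B * X = C"
proof -
  from cols obtain w where w: "\<And>j. j < k \<Longrightarrow> w j \<in> carrier_vec l"
    "\<And>j. j < k \<Longrightarrow> B *\<^sub>v w j = col C j" by metis
  define X where "X = mat l k (\<lambda>(i, j). w j $ i)"
  have X: "X \<in> carrier_mat l k" by (simp add: X_def)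
  have "B * X = C"
  proof (rule eq_matI)
    fix i j assume "i < dim_row C" "j < dim_col C"
    then have ij: "i < n" "j < k" using C by auto
    have "col X j = w j" using w(1)[of j] ij by (intro eq_vecI) (auto simp: X_def)
    then have "(B * X) $$ (i, j) = (B *\<^sub>v w j) $ i" using B X ij by simp
    then show "(B * X) $$ (i, j) = C $$ (i, j)" using w(2)[of j] C ij by auto
  qed (use B C X in auto)
  then show ?thesis using that X by blast
qed

section \<open>Injective matrices as bases of subspaces\<close>

text \<open>Subspaces are handled below as ranges of such matrices, whose columns form a basis;
  invariant subspaces then turn into matrix identities.\<close>

definition inj_mat :: "complex mat \<Rightarrow> bool" where
  "inj_mat B \<longleftrightarrow> (\<forall>v\<in>carrier_vec (dim_col B). B *\<^sub>v v = 0\<^sub>v (dim_row B) \<longrightarrow> v = 0\<^sub>v (dim_col B))"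

lemma inj_mat_vec_cancel:
  assumes "inj_mat B" "B \<in> carrier_mat n l" "v \<in> carrier_vec l" "w \<in> carrier_vec l"
    and "B *\<^sub>v v = B *\<^sub>v w"
  shows "v = w"
proof -
  have "B *\<^sub>v (v - w) = 0\<^sub>v n"
    using assms by (simp add: mult_minus_distrib_mat_vec[of B n l])
  then have "v - w = 0\<^sub>v l" using assms unfolding inj_mat_def by auto
  then show ?thesis using assms(3,4)
    by (metis (no_types, lifting) eq_vecI carrier_vecD index_minus_vec(1) index_zero_vec(1) right_minus_eq)
qed

lemma inj_mat_cancel:
  assumes "inj_mat B" "B \<in> carrier_mat n l" "X \<in> carrier_mat l k" "Y \<in> carrier_mat l k"
    and "B * X = B * Y"
  shows "X = Y"
proof (rule eq_matI_mult_vec)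
  fix v :: "complex vec" assume v: "v \<in> carrier_vec k"
  have "B *\<^sub>v (X *\<^sub>v v) = B *\<^sub>v (Y *\<^sub>v v)"
    using assms v by (metis assoc_mult_mat_vec)
  then show "X *\<^sub>v v = Y *\<^sub>v v"
    using inj_mat_vec_cancel[OF assms(1,2)] assms v by (meson mult_mat_vec_carrier)
qed fact+

lemma inj_mat_mult:
  assumes "inj_mat A" "A \<in> carrier_mat m n" "inj_mat B" "B \<in> carrier_mat n l"
  shows "inj_mat (A * B)"
proof -
  have "v = 0\<^sub>v l" if v: "v \<in> carrier_vec l" and 0: "A * B *\<^sub>v v = 0\<^sub>v m" for v
  proof -
    have "A *\<^sub>v (B *\<^sub>v v) = 0\<^sub>v m" using assms v 0 by (metis assoc_mult_mat_vec)
    then have "B *\<^sub>v v = 0\<^sub>v n" using assms v unfolding inj_mat_def by auto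
    then show ?thesis using assms v unfolding inj_mat_def by auto
  qed
  then show ?thesis using assms unfolding inj_mat_def by auto
qed

lemma inj_mat_square_surj:
  assumes "inj_mat B" "B \<in> carrier_mat n n" "v \<in> carrier_vec n"
  obtains w where "w \<in> carrier_vec n" "B *\<^sub>v w = v"
proof -
  have "det B \<noteq> 0"
    using assms det_0_iff_vec_prod_zero[OF assms(2)] unfolding inj_mat_def by auto
  then obtain C where C: "C \<in> carrier_mat n n" "B * C = 1\<^sub>m n"
    using det_non_zero_imp_unit[OF assms(2), of "TYPE(unit)"]
    unfolding Units_def ring_mat_simps by auto
  show ?thesis
  proof
    show "C *\<^sub>v v \<in> carrier_vec n" using C assms by auto
    show "B *\<^sub>v (C *\<^sub>v v) = v" using C assms by (metis assoc_mult_mat_vec one_mult_mat_vec)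
  qed
qed

text \<open>With more columns than rows, padding by zero rows would give an injective square matrix,
  hence a surjective one. But its range consists of vectors that vanish at coordinate
  \<open>n\<close>, so it misses \<open>unit_vec l n\<close>.\<close>

lemma inj_mat_dim_le:
  assumes inj: "inj_mat B" and B: "B \<in> carrier_mat n l"
  shows "l \<le> n"
proof (rule ccontr)
  assume "\<not> l \<le> n"
  then have nl: "n < l" by simp
  define C where "C = mat l l (\<lambda>(i, j). if i < n then B $$ (i, j) else 0)"
  have C: "C \<in> carrier_mat l l" by (simp add: C_def)
  have r: "C *\<^sub>v v = vec l (\<lambda>i. if i < n then (B *\<^sub>v v) $ i else 0)" if "v \<in> carrier_vec l" for v
    using B nl that by (intro eq_vecI) (auto simp: C_def scalar_prod_def)
  have "inj_mat C" unfolding inj_mat_def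
  proof (intro ballI impI)
    fix v assume v: "v \<in> carrier_vec (dim_col C)" and "C *\<^sub>v v = 0\<^sub>v (dim_row C)"
    then have v': "v \<in> carrier_vec l" and e: "vec l (\<lambda>i. if i < n then (B *\<^sub>v v) $ i else 0) = 0\<^sub>v l"
      using C r by auto
    have "(B *\<^sub>v v) $ i = 0" if "i < n" for i
      using arg_cong[OF e, of "\<lambda>x. x $ i"] nl that by simp
    then have "B *\<^sub>v v = 0\<^sub>v n" using B by (intro eq_vecI) auto
    then show "v = 0\<^sub>v (dim_col C)" using inj B C v' unfolding inj_mat_def by auto
  qed
  then obtain w where w: "w \<in> carrier_vec l" "C *\<^sub>v w = unit_vec l n"
    using inj_mat_square_surj[OF _ C, of "unit_vec l n"] by auto
  have "(C *\<^sub>v w) $ n = 0" using r[OF w(1)] nl by simp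
  then show False using w(2) nl by simp
qed

lemma subspace_basis_mat:
  assumes sub: "VectorSpace.subspace class_ring U (module_vec TYPE(complex) n)"
  obtains l B where "B \<in> carrier_mat n l" "inj_mat B" "U = {B *\<^sub>v x | x. x \<in> carrier_vec l}"
proof -
  from sub have U: "U \<subseteq> carrier_vec n" "0\<^sub>v n \<in> U" "\<And>v w. v \<in> U \<Longrightarrow> w \<in> U \<Longrightarrow> v + w \<in> U"
    "\<And>c v. v \<in> U \<Longrightarrow> c \<cdot>\<^sub>v v \<in> U" unfolding subspace_module_vec_iff by auto
  txt \<open>A matrix with the maximal number of columns among the injective ones with range in \<open>U\<close> works.\<close>
  define Q where "Q l \<longleftrightarrow> (\<exists>B\<in>carrier_mat n l. inj_mat B \<and> (\<forall>x\<in>carrier_vec l. B *\<^sub>v x \<in> U))" for l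
  have "Q 0" unfolding Q_def
  proof (intro bexI conjI ballI)
    show "0\<^sub>m n 0 \<in> carrier_mat n 0" by simp
    show "inj_mat (0\<^sub>m n 0)" unfolding inj_mat_def by auto
    fix x :: "complex vec" assume "x \<in> carrier_vec 0"
    then have "0\<^sub>m n 0 *\<^sub>v x = 0\<^sub>v n" by (intro eq_vecI) (auto simp: scalar_prod_def)
    then show "0\<^sub>m n 0 *\<^sub>v x \<in> U" using U by simp
  qed
  moreover have "Q l \<Longrightarrow> l \<le> n" for l unfolding Q_def using inj_mat_dim_le by blast
  ultimately obtain l where l: "Q l" "\<And>k. Q k \<Longrightarrow> k \<le> l"
    using GreatestI_nat[of Q 0 n] Greatest_le_nat[of Q _ n] by blast
  from l(1) obtain B where B: "B \<in> carrier_mat n l" "inj_mat B"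
    and BU: "\<And>x. x \<in> carrier_vec l \<Longrightarrow> B *\<^sub>v x \<in> U" unfolding Q_def by blast
  have "\<exists>x\<in>carrier_vec l. u = B *\<^sub>v x" if u: "u \<in> U" for u
  proof (rule ccontr)
    assume nx: "\<not> ?thesis"
    \<comment> \<open>\<open>C\<close> is \<open>B\<close> with \<open>u\<close> appended as last
      column. Its injectivity contradicts the maximality of \<open>l\<close>.\<close>
    define C where "C = mat n (Suc l) (\<lambda>(i, j). if j < l then B $$ (i, j) else u $ i)"
    have un: "u \<in> carrier_vec n" using u U by auto
    have C: "C \<in> carrier_mat n (Suc l)" by (simp add: C_def)
    define hd where "hd x = vec l (\<lambda>j. x $ j)" for x :: "complex vec"
    have hd: "hd x \<in> carrier_vec l" for x by (simp add: hd_def)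
    have Cx: "C *\<^sub>v x = B *\<^sub>v hd x + x $ l \<cdot>\<^sub>v u" if "x \<in> carrier_vec (Suc l)" for x
      using B un that
      by (intro eq_vecI) (auto simp: C_def hd_def scalar_prod_def intro!: sum.cong)
    have "inj_mat C" unfolding inj_mat_def
    proof (intro ballI impI)
      fix x assume "x \<in> carrier_vec (dim_col C)" and "C *\<^sub>v x = 0\<^sub>v (dim_row C)"
      then have x: "x \<in> carrier_vec (Suc l)" and e: "B *\<^sub>v hd x + x $ l \<cdot>\<^sub>v u = 0\<^sub>v n"
        using C Cx by auto
      have e': "(B *\<^sub>v hd x) $ i + x $ l * u $ i = 0" if "i < n" for i
        using arg_cong[OF e, of "\<lambda>v. v $ i"] that un B by simp
      have xl: "x $ l = 0"
      proof (rule ccontr)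
        \<comment> \<open>A kernel vector of \<open>C\<close> with nonzero last coordinate could be
          solved for \<open>u\<close>, placing \<open>u\<close> in the range of
          \<open>B\<close>.\<close>
        assume nz: "x $ l \<noteq> 0"
        have "u = B *\<^sub>v ((- 1 / x $ l) \<cdot>\<^sub>v hd x)"
        proof (rule eq_vecI)
          fix i assume "i < dim_vec (B *\<^sub>v ((- 1 / x $ l) \<cdot>\<^sub>v hd x))"
          then have i: "i < n" using B by simp
          have "(B *\<^sub>v ((- 1 / x $ l) \<cdot>\<^sub>v hd x)) $ i = (- 1 / x $ l) * (B *\<^sub>v hd x) $ i"
            using B hd[of x] i by (simp add: mult_mat_vec[of B n l])
          also have "\<dots> = u $ i" using e'[OF i] nz by (simp add: field_simps add_eq_0_iff)
          finally show "u $ i = (B *\<^sub>v ((- 1 / x $ l) \<cdot>\<^sub>v hd x)) $ i" by simp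
        qed (use B un in auto)
        then show False using nx hd[of x] by auto
      qed
      then have "B *\<^sub>v hd x = 0\<^sub>v n" using e' B by (intro eq_vecI) auto
      then have h0: "hd x = 0\<^sub>v l" using B hd[of x] unfolding inj_mat_def by auto
      have "x $ j = 0" if "j < Suc l" for j
        using that xl arg_cong[OF h0, of "\<lambda>v. v $ j"] by (cases "j = l") (auto simp: hd_def)
      then show "x = 0\<^sub>v (dim_col C)" using x C by (intro eq_vecI) auto
    qed
    moreover have "C *\<^sub>v x \<in> U" if "x \<in> carrier_vec (Suc l)" for x
      unfolding Cx[OF that] using U BU hd u by auto
    ultimately have "Q (Suc l)" using C unfolding Q_def by blast
    then show False using l(2)[of "Suc l"] by simp
  qed
  then have "U = {B *\<^sub>v x | x. x \<in> carrier_vec l}" using BU by auto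
  then show ?thesis using that B by blast
qed

section \<open>Schur's lemma\<close>

text \<open>Invertibility of \<open>\<rho> g\<close> is recovered from the right-hand side, with
  \<open>\<rho> (inv g)\<close> as two-sided inverse. Representations can then be treated through
  identities of square matrices.\<close>

lemma (in group) hom_GL_iff:
  "\<rho> \<in> hom G (GL_cplx n) \<longleftrightarrow>
     (\<forall>g\<in>carrier G. \<rho> g \<in> carrier_mat n n) \<and>
     (\<forall>g\<in>carrier G. \<forall>h\<in>carrier G. \<rho> (g \<otimes> h) = \<rho> g * \<rho> h) \<and> \<rho> \<one> = 1\<^sub>m n"
    (is "?L \<longleftrightarrow> ?R")
proof
  interpret R: ring "ring_mat TYPE(complex) n ()" by (rule ring_mat)
  have grp: "Group.group (GL_cplx n)" unfolding GL_cplx_def by (rule R.units_group)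
  have car: "carrier (GL_cplx n) = {A \<in> carrier_mat n n. \<exists>B\<in>carrier_mat n n. B * A = 1\<^sub>m n \<and> A * B = 1\<^sub>m n}"
    by (auto simp: GL_cplx_def units_of_def Units_def ring_mat_simps)
  have ops: "x \<otimes>\<^bsub>GL_cplx n\<^esub> y = x * y" "\<one>\<^bsub>GL_cplx n\<^esub> = 1\<^sub>m n" for x y
    by (auto simp: GL_cplx_def units_of_def ring_mat_simps)
  {
    assume L: ?L
    then have "\<rho> \<one> = 1\<^sub>m n" using hom_one[OF L is_group grp] ops by simp
    then show ?R using L car ops by (auto simp: hom_def Pi_iff)
  next
    assume R: ?R
    have "\<exists>B\<in>carrier_mat n n. B * \<rho> g = 1\<^sub>m n \<and> \<rho> g * B = 1\<^sub>m n" if "g \<in> carrier G" for g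
      using R that by (intro bexI[of _ "\<rho> (inv g)"]) (metis inv_closed l_inv r_inv, simp)
    then show ?L using R car ops by (auto simp: hom_def)
  }
qed

context group
begin

lemma irreducible_repD:
  assumes "irreducible_rep G n \<rho>"
  shows "n > 0" and "g \<in> carrier G \<Longrightarrow> \<rho> g \<in> carrier_mat n n"
    and "g \<in> carrier G \<Longrightarrow> h \<in> carrier G \<Longrightarrow> \<rho> (g \<otimes> h) = \<rho> g * \<rho> h"
    and "\<rho> \<one> = 1\<^sub>m n"
    and "VectorSpace.subspace class_ring W (module_vec TYPE(complex) n) \<Longrightarrow>
      (\<And>g w. g \<in> carrier G \<Longrightarrow> w \<in> W \<Longrightarrow> \<rho> g *\<^sub>v w \<in> W) \<Longrightarrow> W = {0\<^sub>v n} \<or> W = carrier_vec n"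
  using assms by (simp_all add: irreducible_rep_def hom_GL_iff)

text \<open>The kernel of an intertwiner is invariant under \<sigma> and its image is invariant
  under \<tau>. As \<open>A\<close> is nonzero, irreducibility leaves only the zero kernel and the
  full image.\<close>

lemma schur_bijective:
  assumes \<sigma>: "irreducible_rep G n \<sigma>" and \<tau>: "irreducible_rep G m \<tau>"
    and A: "A \<in> carrier_mat m n" and com: "\<And>g. g \<in> carrier G \<Longrightarrow> \<tau> g * A = A * \<sigma> g"
    and nz: "A \<noteq> 0\<^sub>m m n"
  shows "inj_mat A" and "v \<in> carrier_vec m \<Longrightarrow> \<exists>w\<in>carrier_vec n. A *\<^sub>v w = v"
proof -
  note s = irreducible_repD[OF \<sigma>] and t = irreducible_repD[OF \<tau>]
  have com': "\<tau> g *\<^sub>v (A *\<^sub>v w) = A *\<^sub>v (\<sigma> g *\<^sub>v w)" if "g \<in> carrier G" "w \<in> carrier_vec n" for g w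
    using com[OF that(1)] s(2)[OF that(1)] t(2)[OF that(1)] A that(2) by (metis assoc_mult_mat_vec)
  define K where "K = {w \<in> carrier_vec n. A *\<^sub>v w = 0\<^sub>v m}"
  have "VectorSpace.subspace class_ring K (module_vec TYPE(complex) n)"
    unfolding K_def by (rule kernel_subspace[OF A])
  moreover have "\<sigma> g *\<^sub>v w \<in> K" if "g \<in> carrier G" "w \<in> K" for g w
  proof -
    have "\<tau> g *\<^sub>v 0\<^sub>v m = 0\<^sub>v m" using t(2)[OF that(1)] by (intro eq_vecI) auto
    then show ?thesis using that com'[of g w] s(2)[of g] by (auto simp: K_def)
  qed
  ultimately have "K = {0\<^sub>v n} \<or> K = carrier_vec n" by (rule s(5))
  moreover have "K \<noteq> carrier_vec n"
  proof
    assume K: "K = carrier_vec n"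
    have "A = 0\<^sub>m m n"
    proof (rule eq_matI_mult_vec[OF A])
      fix v :: "complex vec" assume "v \<in> carrier_vec n"
      then have "v \<in> K" using K by simp
      then show "A *\<^sub>v v = 0\<^sub>m m n *\<^sub>v v" by (auto simp: K_def)
    qed simp
    then show False using nz by simp
  qed
  ultimately have K: "K = {0\<^sub>v n}" by simp
  then show "inj_mat A" using A unfolding inj_mat_def K_def by auto
  define I where "I = (\<lambda>w. A *\<^sub>v w) ` carrier_vec n"
  have "VectorSpace.subspace class_ring I (module_vec TYPE(complex) m)"
    unfolding subspace_module_vec_iff
  proof (intro conjI ballI allI)
    show "I \<subseteq> carrier_vec m" using A by (auto simp: I_def)
    have "A *\<^sub>v 0\<^sub>v n = 0\<^sub>v m" using A by (intro eq_vecI) auto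
    then show "0\<^sub>v m \<in> I" unfolding I_def by (metis image_eqI zero_carrier_vec)
  next
    fix v w assume "v \<in> I" "w \<in> I"
    then obtain x y where "x \<in> carrier_vec n" "y \<in> carrier_vec n" "v = A *\<^sub>v x" "w = A *\<^sub>v y"
      unfolding I_def by auto
    then show "v + w \<in> I" unfolding I_def
      by (intro image_eqI[of _ _ "x + y"]) (auto simp: mult_add_distrib_mat_vec[OF A])
  next
    fix c v assume "v \<in> I"
    then obtain x where "x \<in> carrier_vec n" "v = A *\<^sub>v x" unfolding I_def by auto
    then show "c \<cdot>\<^sub>v v \<in> I" unfolding I_def
      by (intro image_eqI[of _ _ "c \<cdot>\<^sub>v x"]) (auto simp: mult_mat_vec[OF A])
  qed
  moreover have "\<tau> g *\<^sub>v w \<in> I" if "g \<in> carrier G" "w \<in> I" for g w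
    using that com'[of g] s(2)[of g] unfolding I_def by auto
  ultimately have "I = {0\<^sub>v m} \<or> I = carrier_vec m" by (rule t(5))
  moreover have "I \<noteq> {0\<^sub>v m}"
  proof
    assume "I = {0\<^sub>v m}"
    then have "A *\<^sub>v w = 0\<^sub>v m" if "w \<in> carrier_vec n" for w using that unfolding I_def by blast
    then have "K = carrier_vec n" by (auto simp: K_def)
    then show False using \<open>K \<noteq> carrier_vec n\<close> by simp
  qed
  ultimately have I: "I = carrier_vec m" by blast
  show "\<exists>w\<in>carrier_vec n. A *\<^sub>v w = v" if "v \<in> carrier_vec m"
    using that unfolding I[symmetric] I_def by auto
qed

text \<open>A nonzero intertwiner is invertible, so \<open>\<tau> g\<close> and
  \<open>\<sigma> g\<close> are conjugate. Used contrapositively: irreducible representations with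
  different characters admit only the zero intertwiner.\<close>

lemma schur_equal_trace:
  assumes \<sigma>: "irreducible_rep G n \<sigma>" and \<tau>: "irreducible_rep G m \<tau>"
    and A: "A \<in> carrier_mat m n" and com: "\<And>g. g \<in> carrier G \<Longrightarrow> \<tau> g * A = A * \<sigma> g"
    and nz: "A \<noteq> 0\<^sub>m m n" and g: "g \<in> carrier G"
  shows "mat_trace (\<tau> g) = mat_trace (\<sigma> g)"
proof -
  note bij = schur_bijective[OF \<sigma> \<tau> A com nz]
  obtain B where B: "B \<in> carrier_mat n m" and AB: "A * B = 1\<^sub>m m"
    using mat_factorization_of_cols[OF A one_carrier_mat] bij(2) by (metis col_carrier_vec one_carrier_mat)
  \<comment> \<open>A right inverse of an injective matrix is also a left inverse, by cancelling
    \<open>A\<close>; \<open>n = m\<close> is not known at this point.\<close>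
  have "A * (B * A) = A * 1\<^sub>m n" using A B AB assoc_mult_mat[OF A B A] by simp
  then have BA: "B * A = 1\<^sub>m n" using inj_mat_cancel[OF bij(1) A, of "B * A" n "1\<^sub>m n"] A B by auto
  have s: "\<sigma> g \<in> carrier_mat n n" and t: "\<tau> g \<in> carrier_mat m m"
    using irreducible_repD(2) \<sigma> \<tau> g by auto
  have "\<tau> g = \<tau> g * A * B" using t A B AB by (simp add: assoc_mult_mat[of "\<tau> g" m m A n B m])
  also have "\<dots> = A * \<sigma> g * B" using com g by simp
  also have "mat_trace \<dots> = mat_trace (B * (A * \<sigma> g))"
    using A B s by (intro mat_trace_mult_commute[of _ m n]) auto
  also have "B * (A * \<sigma> g) = \<sigma> g"
    using assoc_mult_mat[OF B A s] BA s by simp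
  finally show ?thesis .
qed

text \<open>For an eigenvalue \<open>c\<close> of \<open>A\<close>, the matrix
  \<open>A - c I\<close> is an intertwiner that is not injective, hence zero. Taking traces
  identifies \<open>c\<close>.\<close>

lemma schur_scalar:
  assumes \<sigma>: "irreducible_rep G n \<sigma>"
    and A: "A \<in> carrier_mat n n" and com: "\<And>g. g \<in> carrier G \<Longrightarrow> \<sigma> g * A = A * \<sigma> g"
  shows "A = (mat_trace A / of_nat n) \<cdot>\<^sub>m 1\<^sub>m n"
proof -
  note s = irreducible_repD[OF \<sigma>]
  obtain c v where v: "v \<in> carrier_vec n" "v \<noteq> 0\<^sub>v n" "A *\<^sub>v v = c \<cdot>\<^sub>v v"
    using complex_eigenvector_exists[OF A s(1)] by blast
  define B where "B = A - c \<cdot>\<^sub>m 1\<^sub>m n"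
  have B: "B \<in> carrier_mat n n" using A by (auto simp: B_def)
  have "\<sigma> g * B = B * \<sigma> g" if "g \<in> carrier G" for g
  proof -
    have "\<sigma> g * (c \<cdot>\<^sub>m 1\<^sub>m n) = c \<cdot>\<^sub>m \<sigma> g"
      using s(2)[OF that] mult_smult_distrib[OF s(2)[OF that] one_carrier_mat[of n], of c] by simp
    then have "\<sigma> g * B = \<sigma> g * A - c \<cdot>\<^sub>m \<sigma> g" using A s(2)[OF that] unfolding B_def
      by (subst mult_minus_distrib_mat[of _ n n]) auto
    also have "\<dots> = B * \<sigma> g" using A s(2)[OF that] com[OF that] unfolding B_def
      by (simp add: minus_mult_distrib_mat[of A n n] mult_smult_assoc_mat[of "1\<^sub>m n" n n])
    finally show ?thesis .
  qed
  moreover have "\<not> inj_mat B"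
  proof
    assume "inj_mat B"
    moreover have "B *\<^sub>v v = 0\<^sub>v n"
proof -
      have "(c \<cdot>\<^sub>m 1\<^sub>m n) *\<^sub>v v = c \<cdot>\<^sub>v v" using v(1) by (intro eq_vecI) auto
      then show ?thesis using A v unfolding B_def by (simp add: minus_mult_distrib_mat_vec[of A n n])
    qed
    ultimately show False using v B unfolding inj_mat_def by auto
  qed
  ultimately have "B = 0\<^sub>m n n" using schur_bijective(1)[OF \<sigma> \<sigma> B] by blast
  then have e: "A $$ (i, j) = (c \<cdot>\<^sub>m 1\<^sub>m n) $$ (i, j)" if "i < n" "j < n" for i j
  proof -
    have "B $$ (i, j) = 0" using \<open>B = 0\<^sub>m n n\<close> that by simp
    then show ?thesis using A that by (auto simp: B_def)
  qed
  then have Ac: "A = c \<cdot>\<^sub>m 1\<^sub>m n" using A by (intro eq_matI) auto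
  then have "mat_trace A = of_nat n * c" by (simp add: mat_trace_def)
  then show ?thesis using Ac s(1) by simp
qed

end

section \<open>Orthogonality relations and irreducible subrepresentations\<close>

context group
begin

section \<open>Averaging over the group and Schur orthogonality\<close>

lemma sum_cmult_left_reindex:
  assumes "h \<in> carrier G"
  shows "(\<Sum>g\<in>carrier G. F (h \<otimes> g)) = (\<Sum>g\<in>carrier G. F g)"
  by (rule sum.reindex_bij_betw) (use assms inj_on_cmult surj_const_mult in \<open>auto simp: bij_betw_def\<close>)

lemma sum_conj_reindex:
  assumes h: "h \<in> carrier G"
  shows "(\<Sum>g\<in>carrier G. F (h \<otimes> g \<otimes> inv h)) = (\<Sum>g\<in>carrier G. F g)"
proof (rule sum.reindex_bij_betw)
  have "inv h \<otimes> (h \<otimes> a) = a" "h \<otimes> (inv h \<otimes> a) = a" if "a \<in> carrier G" for a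
    using h that by (simp_all flip: m_assoc)
  then show "bij_betw (\<lambda>g. h \<otimes> g \<otimes> inv h) (carrier G) (carrier G)"
    by (intro bij_betw_byWitness[of _ "\<lambda>g. inv h \<otimes> g \<otimes> h"]) (use h in \<open>auto simp: m_assoc\<close>)
qed

text \<open>\<open>T\<close> is the sum over \<open>g\<close> of
  \<open>\<sigma> g * E * \<tau> (inv g)\<close>, where \<open>E\<close> is the matrix unit with its
  1 at position \<open>(b, c)\<close>. Averaging turns an arbitrary matrix into an intertwiner, and
  this choice of \<open>E\<close> makes its entries the sums of the orthogonality relations.\<close>

lemma coefficient_average_intertwines:
  fixes \<sigma> \<tau> :: "'a \<Rightarrow> complex mat" and n m b c :: nat
  defines "T \<equiv> mat n m (\<lambda>(a, d). \<Sum>g\<in>carrier G. \<sigma> g $$ (a, b) * \<tau> (inv g) $$ (c, d))"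
  assumes \<sigma>: "irreducible_rep G n \<sigma>" and \<tau>: "irreducible_rep G m \<tau>"
    and b: "b < n" and c: "c < m" and h: "h \<in> carrier G"
  shows "\<sigma> h * T = T * \<tau> h"
proof (rule eq_matI)
  note s = irreducible_repD[OF \<sigma>] and t = irreducible_repD[OF \<tau>]
  have T: "T \<in> carrier_mat n m" by (simp add: T_def)
  show "dim_row (\<sigma> h * T) = dim_row (T * \<tau> h)" "dim_col (\<sigma> h * T) = dim_col (T * \<tau> h)"
    using T s(2)[OF h] t(2)[OF h] by auto
  fix a d assume "a < dim_row (T * \<tau> h)" "d < dim_col (T * \<tau> h)"
  then have a: "a < n" and d: "d < m" using T t(2)[OF h] by auto
  have "(\<sigma> h * T) $$ (a, d) =
      (\<Sum>k<n. \<sigma> h $$ (a, k) * (\<Sum>g\<in>carrier G. \<sigma> g $$ (k, b) * \<tau> (inv g) $$ (c, d)))"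
    using T s(2)[OF h] a d by (subst mat_mult_entry[of _ n n]) (auto simp: T_def)
  also have "\<dots> = (\<Sum>g\<in>carrier G. (\<Sum>k<n. \<sigma> h $$ (a, k) * \<sigma> g $$ (k, b)) * \<tau> (inv g) $$ (c, d))"
    by (simp add: sum_distrib_left sum_distrib_right mult.assoc) (rule sum.swap)
  \<comment> \<open>Replacing \<open>inv g\<close> by \<open>inv (h \<otimes> g) \<otimes> h\<close>
    makes the summand a function of \<open>h \<otimes> g\<close> alone, ready for reindexing by left
    translation.\<close>
  also have "\<dots> = (\<Sum>g\<in>carrier G. \<sigma> (h \<otimes> g) $$ (a, b) * \<tau> (inv (h \<otimes> g) \<otimes> h) $$ (c, d))"
  proof (rule sum.cong)
    fix g assume g: "g \<in> carrier G"
    have "inv (h \<otimes> g) \<otimes> h = inv g" using g h by (simp add: inv_mult_group m_assoc)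
    then show "(\<Sum>k<n. \<sigma> h $$ (a, k) * \<sigma> g $$ (k, b)) * \<tau> (inv g) $$ (c, d) =
        \<sigma> (h \<otimes> g) $$ (a, b) * \<tau> (inv (h \<otimes> g) \<otimes> h) $$ (c, d)"
      using s(3)[OF h g] mat_mult_entry[OF s(2)[OF h] s(2)[OF g] a b] by simp
  qed simp
  also have "\<dots> = (\<Sum>g\<in>carrier G. \<sigma> g $$ (a, b) * \<tau> (inv g \<otimes> h) $$ (c, d))"
    by (rule sum_cmult_left_reindex[OF h])
  also have "\<dots> = (\<Sum>g\<in>carrier G. \<sigma> g $$ (a, b) * (\<Sum>k<m. \<tau> (inv g) $$ (c, k) * \<tau> h $$ (k, d)))"
    using t(2,3) h c d by (intro sum.cong) (auto simp: mat_mult_entry[of _ m m _ m] simp del: index_mult_mat(1))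
  also have "\<dots> = (\<Sum>k<m. (\<Sum>g\<in>carrier G. \<sigma> g $$ (a, b) * \<tau> (inv g) $$ (c, k)) * \<tau> h $$ (k, d))"
    by (simp add: sum_distrib_left sum_distrib_right mult.assoc) (rule sum.swap)
  also have "\<dots> = (T * \<tau> h) $$ (a, d)"
    using T t(2)[OF h] a d by (subst mat_mult_entry[of _ n m]) (auto simp: T_def)
  finally show "(\<sigma> h * T) $$ (a, d) = (T * \<tau> h) $$ (a, d)" .
qed

text \<open>The sum is an entry of an averaged intertwiner from \<tau> to \<sigma>, which must
  vanish since the characters differ at \<open>g0\<close>.\<close>

lemma coefficient_orthogonality_distinct:
  assumes \<sigma>: "irreducible_rep G n \<sigma>" and \<tau>: "irreducible_rep G m \<tau>"
    and ne: "g0 \<in> carrier G" "mat_trace (\<sigma> g0) \<noteq> mat_trace (\<tau> g0)"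
    and idx: "a < n" "b < n" "c < m" "d < m"
  shows "(\<Sum>g\<in>carrier G. \<sigma> g $$ (a, b) * \<tau> (inv g) $$ (c, d)) = 0"
proof -
  let ?T = "mat n m (\<lambda>(a, d). \<Sum>g\<in>carrier G. \<sigma> g $$ (a, b) * \<tau> (inv g) $$ (c, d))"
  have "?T = 0\<^sub>m n m"
    using schur_equal_trace[OF \<tau> \<sigma> _ coefficient_average_intertwines[OF \<sigma> \<tau> idx(2,3)]] ne by auto
  then have "?T $$ (a, d) = 0" using idx by simp
  then show ?thesis using idx by simp
qed

text \<open>By Schur's lemma the averaged matrix is scalar, so its trace suffices. Summing over the
  diagonal first gives the \<open>(c, b)\<close> entry of
  \<open>\<sigma> (inv g) * \<sigma> g\<close>, that is, of the identity matrix.\<close>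

lemma coefficient_orthogonality_same:
  assumes \<sigma>: "irreducible_rep G n \<sigma>" and idx: "a < n" "b < n" "c < n" "d < n"
  shows "(\<Sum>g\<in>carrier G. \<sigma> g $$ (a, b) * \<sigma> (inv g) $$ (c, d)) =
    (if a = d \<and> b = c then of_nat (card (carrier G)) / of_nat n else 0)"
proof -
  note s = irreducible_repD[OF \<sigma>]
  let ?T = "mat n n (\<lambda>(a, d). \<Sum>g\<in>carrier G. \<sigma> g $$ (a, b) * \<sigma> (inv g) $$ (c, d))"
  have T: "?T = (mat_trace ?T / of_nat n) \<cdot>\<^sub>m 1\<^sub>m n"
    by (rule schur_scalar[OF \<sigma> _ coefficient_average_intertwines[OF \<sigma> \<sigma> idx(2,3)]]) auto
  have "mat_trace ?T = (\<Sum>k<n. \<Sum>g\<in>carrier G. \<sigma> (inv g) $$ (c, k) * \<sigma> g $$ (k, b))"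
    by (auto simp: mat_trace_def mult.commute)
  also have "\<dots> = (\<Sum>g\<in>carrier G. \<Sum>k<n. \<sigma> (inv g) $$ (c, k) * \<sigma> g $$ (k, b))"
    by (rule sum.swap)
  also have "\<dots> = (\<Sum>g\<in>carrier G. if b = c then 1 else 0)"
  proof (rule sum.cong)
    fix g assume g: "g \<in> carrier G"
    have "(\<Sum>k<n. \<sigma> (inv g) $$ (c, k) * \<sigma> g $$ (k, b)) = (\<sigma> (inv g) * \<sigma> g) $$ (c, b)"
      using mat_mult_entry[OF s(2) s(2) idx(3,2)] g by simp
    also have "\<sigma> (inv g) * \<sigma> g = 1\<^sub>m n" using s(3)[of "inv g" g] s(4) g by simp
    finally show "(\<Sum>k<n. \<sigma> (inv g) $$ (c, k) * \<sigma> g $$ (k, b)) = (if b = c then 1 else 0)"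
      using idx by auto
  qed simp
  also have "\<dots> = (if b = c then of_nat (card (carrier G)) else 0)" by simp
  finally have tr: "mat_trace ?T = (if b = c then of_nat (card (carrier G)) else 0)" .
  have "?T $$ (a, d) = (mat_trace ?T / of_nat n) * (if a = d then 1 else 0)"
    using idx by (subst T) auto
  then show ?thesis using idx unfolding tr by auto
qed

text \<open>The matrix \<open>M\<close>, the sum of the \<open>f g\<close> multiples of
  \<open>\<sigma> g\<close>, commutes with every \<open>\<sigma> h\<close>, because conjugation by
  \<open>h\<close> permutes the group and preserves \<open>f\<close>. Hence it is scalar, with the
  scalar given by its trace.\<close>

lemma class_function_scalar:
  assumes \<sigma>: "irreducible_rep G n \<sigma>"
    and f: "\<And>g h. g \<in> carrier G \<Longrightarrow> h \<in> carrier G \<Longrightarrow> f (h \<otimes> g \<otimes> inv h) = f g"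
    and ab: "a < n" "b < n"
  shows "(\<Sum>g\<in>carrier G. f g * \<sigma> g $$ (a, b)) =
    (if a = b then (\<Sum>g\<in>carrier G. f g * mat_trace (\<sigma> g)) / of_nat n else 0)"
proof -
  note s = irreducible_repD[OF \<sigma>]
  define M where "M = mat n n (\<lambda>(a, b). \<Sum>g\<in>carrier G. f g * \<sigma> g $$ (a, b))"
  have M: "M \<in> carrier_mat n n" by (simp add: M_def)
  have "\<sigma> h * M = M * \<sigma> h" if h: "h \<in> carrier G" for h
  proof (rule eq_matI)
    show "dim_row (\<sigma> h * M) = dim_row (M * \<sigma> h)" "dim_col (\<sigma> h * M) = dim_col (M * \<sigma> h)"
      using M s(2)[OF h] by auto
    fix i j assume "i < dim_row (M * \<sigma> h)" "j < dim_col (M * \<sigma> h)"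
    then have i: "i < n" and j: "j < n" using M s(2)[OF h] by auto
    have "(\<sigma> h * M) $$ (i, j) = (\<Sum>k<n. \<sigma> h $$ (i, k) * (\<Sum>g\<in>carrier G. f g * \<sigma> g $$ (k, j)))"
      using M s(2)[OF h] i j by (subst mat_mult_entry[of _ n n]) (auto simp: M_def)
    also have "\<dots> = (\<Sum>g\<in>carrier G. f g * (\<Sum>k<n. \<sigma> h $$ (i, k) * \<sigma> g $$ (k, j)))"
      by (simp add: sum_distrib_left mult.left_commute) (rule sum.swap)
    also have "\<dots> = (\<Sum>g\<in>carrier G. f (h \<otimes> g \<otimes> inv h) * \<sigma> (h \<otimes> g \<otimes> inv h \<otimes> h) $$ (i, j))"
    proof (rule sum.cong)
      fix g assume g: "g \<in> carrier G"
      have "h \<otimes> g \<otimes> inv h \<otimes> h = h \<otimes> g" using g h by (simp add: m_assoc)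
      then show "f g * (\<Sum>k<n. \<sigma> h $$ (i, k) * \<sigma> g $$ (k, j)) =
          f (h \<otimes> g \<otimes> inv h) * \<sigma> (h \<otimes> g \<otimes> inv h \<otimes> h) $$ (i, j)"
        using s(3)[OF h g] mat_mult_entry[OF s(2)[OF h] s(2)[OF g] i j] f[OF g h] by simp
    qed simp
    also have "\<dots> = (\<Sum>g\<in>carrier G. f g * \<sigma> (g \<otimes> h) $$ (i, j))"
      by (rule sum_conj_reindex[OF h])
    also have "\<dots> = (\<Sum>g\<in>carrier G. f g * (\<Sum>k<n. \<sigma> g $$ (i, k) * \<sigma> h $$ (k, j)))"
      using s(2,3) h i j
      by (intro sum.cong) (auto simp: mat_mult_entry[of _ n n _ n] simp del: index_mult_mat(1))
    also have "\<dots> = (\<Sum>k<n. (\<Sum>g\<in>carrier G. f g * \<sigma> g $$ (i, k)) * \<sigma> h $$ (k, j))"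
      by (simp add: sum_distrib_left sum_distrib_right mult.assoc) (rule sum.swap)
    also have "\<dots> = (M * \<sigma> h) $$ (i, j)"
      using M s(2)[OF h] i j by (subst mat_mult_entry[of _ n n]) (auto simp: M_def)
    finally show "(\<sigma> h * M) $$ (i, j) = (M * \<sigma> h) $$ (i, j)" .
  qed
  then have Ms: "M = (mat_trace M / of_nat n) \<cdot>\<^sub>m 1\<^sub>m n" by (rule schur_scalar[OF \<sigma> M])
  have "mat_trace M = (\<Sum>k<n. \<Sum>g\<in>carrier G. f g * \<sigma> g $$ (k, k))"
    by (auto simp: mat_trace_def M_def)
  also have "\<dots> = (\<Sum>g\<in>carrier G. \<Sum>k<n. f g * \<sigma> g $$ (k, k))" by (rule sum.swap)
  also have "\<dots> = (\<Sum>g\<in>carrier G. f g * mat_trace (\<sigma> g))"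
    using s(2) by (intro sum.cong) (auto simp: mat_trace_def sum_distrib_left)
  finally have tr: "mat_trace M = (\<Sum>g\<in>carrier G. f g * mat_trace (\<sigma> g))" .
  have "M $$ (a, b) = (mat_trace M / of_nat n) * (if a = b then 1 else 0)"
    using ab by (subst Ms) auto
  then show ?thesis using ab unfolding tr by (auto simp: M_def)
qed

section \<open>Restriction to invariant subspaces and existence of irreducible ones\<close>

text \<open>\<open>\<rho>'\<close> is the restriction of \<rho> to the range of \<open>B\<close>,
  written in the basis of columns of \<open>B\<close>. Invariance gives each matrix
  \<open>\<rho>' g\<close>, and cancelling the injective \<open>B\<close> gives
  multiplicativity.\<close>

lemma restrict_rep:
  assumes \<rho>: "\<rho> \<in> hom G (GL_cplx n)" and B: "B \<in> carrier_mat n l" "inj_mat B"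
    and inv: "\<And>g x. g \<in> carrier G \<Longrightarrow> x \<in> carrier_vec l \<Longrightarrow> \<exists>y\<in>carrier_vec l. B *\<^sub>v y = \<rho> g *\<^sub>v (B *\<^sub>v x)"
  obtains \<rho>' where "\<rho>' \<in> hom G (GL_cplx l)" "\<And>g. g \<in> carrier G \<Longrightarrow> \<rho> g * B = B * \<rho>' g"
proof -
  note r = \<rho>[unfolded hom_GL_iff]
  have "\<exists>X\<in>carrier_mat l l. B * X = \<rho> g * B" if g: "g \<in> carrier G" for g
  proof -
    have rg: "\<rho> g \<in> carrier_mat n n" using r g by blast
    have "\<exists>y\<in>carrier_vec l. B *\<^sub>v y = col (\<rho> g * B) j" if "j < l" for j
      using inv[OF g, of "unit_vec l j"] that mat_mult_unit_vec[OF B(1) that] col_mult2[OF rg B(1) that]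
      by simp
    then obtain X where "X \<in> carrier_mat l l" "B * X = \<rho> g * B"
      using mat_factorization_of_cols[OF B(1) mult_carrier_mat[OF rg B(1)]] by metis
    then show ?thesis by blast
  qed
  then obtain X where X: "\<And>g. g \<in> carrier G \<Longrightarrow> X g \<in> carrier_mat l l"
    and BX: "\<And>g. g \<in> carrier G \<Longrightarrow> B * X g = \<rho> g * B" by metis
  have "X (g \<otimes> h) = X g * X h" if g: "g \<in> carrier G" and h: "h \<in> carrier G" for g h
  proof (rule inj_mat_cancel[OF B(2,1)])
    have c: "\<rho> g \<in> carrier_mat n n" "\<rho> h \<in> carrier_mat n n" using r g h by blast+
    have "B * X (g \<otimes> h) = \<rho> g * \<rho> h * B" using BX[of "g \<otimes> h"] r g h by simp
    also have "\<dots> = \<rho> g * (B * X h)" using c B BX[OF h] by (simp add: assoc_mult_mat[of _ n n _ n _ l])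
    also have "\<dots> = (\<rho> g * B) * X h" by (rule assoc_mult_mat[OF c(1) B(1) X[OF h], symmetric])
    also have "\<dots> = B * (X g * X h)"
      using assoc_mult_mat[OF B(1) X[OF g] X[OF h]] BX[OF g] by simp
    finally show "B * X (g \<otimes> h) = B * (X g * X h)" .
    show "X (g \<otimes> h) \<in> carrier_mat l l" "X g * X h \<in> carrier_mat l l"
      using X g h by (auto intro!: mult_carrier_mat[of _ l l])
  qed
  moreover have "X \<one> = 1\<^sub>m l"
    using inj_mat_cancel[OF B(2,1), of "X \<one>" l "1\<^sub>m l"] X[of \<one>] BX[of \<one>] r B by simp
  ultimately have "X \<in> hom G (GL_cplx l)" unfolding hom_GL_iff using X by blast
  then show ?thesis using that BX by metis
qed

text \<open>Strong induction on the degree: if \<rho> is reducible, its restriction to a proper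
  nonzero invariant subspace has smaller positive degree. The injective embeddings \<open>B\<close>
  and \<open>A\<close> compose to the required one.\<close>

lemma irreducible_subrep_exists:
  assumes "n > 0" and "\<rho> \<in> hom G (GL_cplx n)"
  shows "\<exists>k \<sigma> A. irreducible_rep G k \<sigma> \<and> A \<in> carrier_mat n k \<and> inj_mat A \<and>
    (\<forall>g\<in>carrier G. \<rho> g * A = A * \<sigma> g)"
  using assms
proof (induction n arbitrary: \<rho> rule: less_induct)
  case (less n)
  note r = less.prems(2)[unfolded hom_GL_iff]
  show ?case
  proof (cases "irreducible_rep G n \<rho>")
    case True
    have "inj_mat (1\<^sub>m n)" unfolding inj_mat_def by auto
    moreover have "\<forall>g\<in>carrier G. \<rho> g * 1\<^sub>m n = 1\<^sub>m n * \<rho> g" using r by auto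
    ultimately show ?thesis using True one_carrier_mat by blast
  next
    case False
    then have "\<not> (\<forall>W. VectorSpace.subspace class_ring W (module_vec TYPE(complex) n) \<and>
        (\<forall>g\<in>carrier G. \<forall>w\<in>W. \<rho> g *\<^sub>v w \<in> W) \<longrightarrow> W = {0\<^sub>v n} \<or> W = carrier_vec n)"
      using less.prems unfolding irreducible_rep_def by simp
    then obtain W where W: "VectorSpace.subspace class_ring W (module_vec TYPE(complex) n)"
      "\<And>g w. g \<in> carrier G \<Longrightarrow> w \<in> W \<Longrightarrow> \<rho> g *\<^sub>v w \<in> W" "W \<noteq> {0\<^sub>v n}" "W \<noteq> carrier_vec n"
      by blast
    obtain l B where B: "B \<in> carrier_mat n l" "inj_mat B" and WB: "W = {B *\<^sub>v x | x. x \<in> carrier_vec l}"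
      by (rule subspace_basis_mat[OF W(1)])
    have "l \<noteq> 0"
    proof
      assume "l = 0"
      then have "B *\<^sub>v x = 0\<^sub>v n" if "x \<in> carrier_vec l" for x
        using that B by (intro eq_vecI) (auto simp: scalar_prod_def)
      then have "W \<subseteq> {0\<^sub>v n}" unfolding WB by auto
      moreover have "0\<^sub>v n \<in> W" using W(1) unfolding subspace_module_vec_iff by simp
      ultimately show False using W(3) by auto
    qed
    moreover have "l \<noteq> n"
    proof
      assume "l = n"
      have "v \<in> W" if v: "v \<in> carrier_vec n" for v
      proof -
        have "B \<in> carrier_mat n n" using B(1) \<open>l = n\<close> by simp
        then obtain w where "w \<in> carrier_vec n" "B *\<^sub>v w = v"
          by (rule inj_mat_square_surj[OF B(2) _ v])
        then show ?thesis unfolding WB using \<open>l = n\<close> by auto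
      qed
      then have "carrier_vec n \<subseteq> W" by blast
      then show False using W(1,4) unfolding subspace_module_vec_iff by auto
    qed
    ultimately have l: "0 < l" "l < n" using inj_mat_dim_le[OF B(2,1)] by auto
    have "\<exists>y\<in>carrier_vec l. B *\<^sub>v y = \<rho> g *\<^sub>v (B *\<^sub>v x)" if "g \<in> carrier G" "x \<in> carrier_vec l" for g x
    proof -
      have "B *\<^sub>v x \<in> W" using that(2) unfolding WB by blast
      then have "\<rho> g *\<^sub>v (B *\<^sub>v x) \<in> W" by (rule W(2)[OF that(1)])
      then show ?thesis unfolding WB by auto
    qed
    then obtain \<rho>' where \<rho>': "\<rho>' \<in> hom G (GL_cplx l)" "\<And>g. g \<in> carrier G \<Longrightarrow> \<rho> g * B = B * \<rho>' g"
      using restrict_rep[OF less.prems(2) B] by blast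
    from less.IH[OF l(2,1) \<rho>'(1)] obtain k \<sigma> A where A: "irreducible_rep G k \<sigma>" "A \<in> carrier_mat l k"
      "inj_mat A" "\<And>g. g \<in> carrier G \<Longrightarrow> \<rho>' g * A = A * \<sigma> g" by blast
    have "\<rho> g * (B * A) = B * A * \<sigma> g" if g: "g \<in> carrier G" for g
    proof -
      have c: "\<rho> g \<in> carrier_mat n n" "\<rho>' g \<in> carrier_mat l l" "\<sigma> g \<in> carrier_mat k k"
        using r \<rho>'(1)[unfolded hom_GL_iff] irreducible_repD(2)[OF A(1)] g by auto
      then show ?thesis
        using assoc_mult_mat[OF c(1) B(1) A(2)] assoc_mult_mat[OF B(1) c(2) A(2)]
          assoc_mult_mat[OF B(1) A(2) c(3)] \<rho>'(2)[OF g] A(4)[OF g] by simp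
    qed
    moreover have "inj_mat (B * A)" "B * A \<in> carrier_mat n k"
      using inj_mat_mult[OF B(2,1) A(3,2)] B A by auto
    ultimately show ?thesis using A(1) by blast
  qed
qed

end

section \<open>Completeness of the matrix coefficients\<close>

lemma inj_mat_left_inverse:
  assumes "C \<in> carrier_mat l n" "B \<in> carrier_mat n l" "C * B = 1\<^sub>m l"
  shows "inj_mat B"
  unfolding inj_mat_def
proof (intro ballI impI)
  fix v assume "v \<in> carrier_vec (dim_col B)" and 0: "B *\<^sub>v v = 0\<^sub>v (dim_row B)"
  then have v: "v \<in> carrier_vec l" using assms by auto
  have "v = C * B *\<^sub>v v" using assms(3) v by simp
  also have "\<dots> = C *\<^sub>v 0\<^sub>v n" using assoc_mult_mat_vec[OF assms(1,2) v] 0 assms(2) by simp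
  also have "\<dots> = 0\<^sub>v l" using assms(1) by (intro eq_vecI) auto
  finally show "v = 0\<^sub>v (dim_col B)" using assms(2) by simp
qed

lemma sum_nth_distinct:
  assumes "distinct xs" "set xs = A"
  shows "(\<Sum>i<length xs. F (xs ! i)) = sum F A"
  by (rule sum.reindex_bij_betw) (use assms bij_betw_nth in auto)

context group
begin

section \<open>Matrix coefficients as eigenfunctions, and orthogonality of characters\<close>

text \<open>The substitution \<open>y = g \<otimes> x\<close> and the product formula for
  \<open>\<sigma> (g \<otimes> x)\<close> bring out the sum of \<open>f g * \<sigma> g\<close>,
  which is scalar by \<open>class_function_scalar\<close>. The row index \<open>a\<close> thus
  survives unchanged and \<open>b\<close> is never touched.\<close>

lemma coefficient_eigenfunction:
  assumes \<sigma>: "irreducible_rep G n \<sigma>"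
    and f: "\<And>g h. g \<in> carrier G \<Longrightarrow> h \<in> carrier G \<Longrightarrow> f (h \<otimes> g \<otimes> inv h) = f g"
    and ab: "a < n" "b < n" and x: "x \<in> carrier G"
  shows "(\<Sum>y\<in>carrier G. f (y \<otimes> inv x) * \<sigma> y $$ (a, b)) =
    (\<Sum>g\<in>carrier G. f g * mat_trace (\<sigma> g)) / of_nat n * \<sigma> x $$ (a, b)"
proof -
  note s = irreducible_repD[OF \<sigma>]
  have "(\<Sum>y\<in>carrier G. f (y \<otimes> inv x) * \<sigma> y $$ (a, b)) =
      (\<Sum>g\<in>carrier G. f (g \<otimes> x \<otimes> inv x) * \<sigma> (g \<otimes> x) $$ (a, b))"
    by (rule sum.reindex_bij_betw[symmetric])
      (use x inj_on_multc surj_const_mult in \<open>auto intro!: bij_betw_byWitness[of _ "\<lambda>g. g \<otimes> inv x"] simp: m_assoc\<close>)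
  also have "\<dots> = (\<Sum>g\<in>carrier G. f g * (\<Sum>k<n. \<sigma> g $$ (a, k) * \<sigma> x $$ (k, b)))"
    using x s(2,3) ab by (intro sum.cong) (auto simp: m_assoc mat_mult_entry[of _ n n _ n] simp del: index_mult_mat(1))
  also have "\<dots> = (\<Sum>k<n. (\<Sum>g\<in>carrier G. f g * \<sigma> g $$ (a, k)) * \<sigma> x $$ (k, b))"
    by (simp add: sum_distrib_left sum_distrib_right mult.assoc) (rule sum.swap)
  also have "\<dots> = (\<Sum>k<n. if k = a then (\<Sum>g\<in>carrier G. f g * mat_trace (\<sigma> g)) / of_nat n * \<sigma> x $$ (a, b) else 0)"
    using class_function_scalar[OF \<sigma> f ab(1)] by (intro sum.cong) auto
  finally show ?thesis using ab by simp
qed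

lemma sum_inv_reindex: "(\<Sum>g\<in>carrier G. F (inv g)) = (\<Sum>g\<in>carrier G. F g)"
  by (rule sum.reindex_bij_betw) (auto intro!: bij_betw_byWitness[of _ "\<lambda>g. inv g"])

text \<open>Both traces are expanded into diagonal coefficients. The cases are separated by equality
  of characters, not by isomorphism: if the characters agree, \<sigma> is replaced by \<tau> and
  only the relations for a single representation are used.\<close>

lemma character_inner_product:
  assumes \<tau>: "irreducible_rep G k \<tau>" and \<sigma>: "irreducible_rep G m \<sigma>"
  shows "(\<Sum>g\<in>carrier G. mat_trace (\<tau> g) * mat_trace (\<sigma> (inv g))) =
    (if \<forall>g\<in>carrier G. mat_trace (\<tau> g) = mat_trace (\<sigma> g) then of_nat (card (carrier G)) else 0)"
proof -
  have exp: "(\<Sum>g\<in>carrier G. mat_trace (\<tau> g) * mat_trace (\<sigma>' (inv g))) =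
      (\<Sum>a<k. \<Sum>c<m'. \<Sum>g\<in>carrier G. \<tau> g $$ (a, a) * \<sigma>' (inv g) $$ (c, c))"
    if \<sigma>': "irreducible_rep G m' \<sigma>'" for m' \<sigma>'
  proof -
    have "(\<Sum>g\<in>carrier G. mat_trace (\<tau> g) * mat_trace (\<sigma>' (inv g))) =
        (\<Sum>g\<in>carrier G. \<Sum>a<k. \<Sum>c<m'. \<tau> g $$ (a, a) * \<sigma>' (inv g) $$ (c, c))"
      using irreducible_repD(2)[OF \<tau>] irreducible_repD(2)[OF \<sigma>']
      by (intro sum.cong) (auto simp: mat_trace_eq[of _ k] mat_trace_eq[of _ m'] sum_product)
    also have "\<dots> = (\<Sum>a<k. \<Sum>g\<in>carrier G. \<Sum>c<m'. \<tau> g $$ (a, a) * \<sigma>' (inv g) $$ (c, c))"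
      by (rule sum.swap)
    also have "\<dots> = (\<Sum>a<k. \<Sum>c<m'. \<Sum>g\<in>carrier G. \<tau> g $$ (a, a) * \<sigma>' (inv g) $$ (c, c))"
      by (intro sum.cong refl sum.swap)
    finally show ?thesis .
  qed
  show ?thesis
  proof (cases "\<forall>g\<in>carrier G. mat_trace (\<tau> g) = mat_trace (\<sigma> g)")
    case True
    then have "(\<Sum>g\<in>carrier G. mat_trace (\<tau> g) * mat_trace (\<sigma> (inv g))) =
        (\<Sum>g\<in>carrier G. mat_trace (\<tau> g) * mat_trace (\<tau> (inv g)))" by (intro sum.cong) auto
    also have "\<dots> = (\<Sum>a<k. \<Sum>c<k. if c = a then of_nat (card (carrier G)) / of_nat k else 0)"
      unfolding exp[OF \<tau>] by (intro sum.cong refl) (auto simp: coefficient_orthogonality_same[OF \<tau>])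
    also have "\<dots> = of_nat (card (carrier G))" using irreducible_repD(1)[OF \<tau>] by simp
    finally show ?thesis using True by simp
  next
    case False
    then obtain g where "g \<in> carrier G" "mat_trace (\<tau> g) \<noteq> mat_trace (\<sigma> g)" by blast
    then show ?thesis unfolding exp[OF \<sigma>]
      using False by (auto simp: coefficient_orthogonality_distinct[OF \<tau> \<sigma>] intro!: sum.neutral)
  qed
qed

lemma mat_trace_rep_one:
  assumes "irreducible_rep G n \<rho>"
  shows "mat_trace (\<rho> \<one>) = of_nat n"
  using irreducible_repD(4)[OF assms] by (simp add: mat_trace_def)

lemma mat_trace_rep_conj:
  assumes \<rho>: "irreducible_rep G n \<rho>" and g: "g \<in> carrier G" and h: "h \<in> carrier G"
  shows "mat_trace (\<rho> (h \<otimes> g \<otimes> inv h)) = mat_trace (\<rho> g)"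
proof -
  note r = irreducible_repD[OF \<rho>]
  have "mat_trace (\<rho> (h \<otimes> g \<otimes> inv h)) = mat_trace (\<rho> (h \<otimes> g) * \<rho> (inv h))" using r(3) g h by simp
  also have "\<dots> = mat_trace (\<rho> (inv h) * \<rho> (h \<otimes> g))"
    using r(2) g h by (intro mat_trace_mult_commute[of _ n n]) auto
  also have "\<rho> (inv h) * \<rho> (h \<otimes> g) = \<rho> (inv h \<otimes> (h \<otimes> g))" using r(3) g h by simp
  also have "inv h \<otimes> (h \<otimes> g) = g" using g h by (simp flip: m_assoc)
  finally show ?thesis .
qed

section \<open>The right regular representation\<close>

text \<open>The operator sending a function \<open>F\<close> to
  \<open>\<lambda>x. F (x \<otimes> g)\<close>, in coordinates given by \<open>vs\<close>.
  Translating on the right leaves every kernel in \<open>x \<otimes> inv y\<close>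
  invariant.\<close>

definition right_translation :: "'a list \<Rightarrow> 'a \<Rightarrow> complex mat" where
  "right_translation vs g =
     mat (length vs) (length vs) (\<lambda>(u, v). if vs ! v = vs ! u \<otimes> g then 1 else 0)"

lemma right_translation_mult:
  assumes vs: "distinct vs" "set vs = carrier G" and g: "g \<in> carrier G"
    and M: "M \<in> carrier_mat (length vs) k" "\<And>v i. v < length vs \<Longrightarrow> i < k \<Longrightarrow> M $$ (v, i) = F (vs ! v) i"
    and ui: "u < length vs" "i < k"
  shows "(right_translation vs g * M) $$ (u, i) = F (vs ! u \<otimes> g) i"
proof -
  have xu: "vs ! u \<in> carrier G" using nth_mem[OF ui(1)] vs(2) by simp
  have "(right_translation vs g * M) $$ (u, i) =
      (\<Sum>v<length vs. (if vs ! v = vs ! u \<otimes> g then 1 else 0) * F (vs ! v) i)"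
    using M ui by (subst mat_mult_entry[OF _ M(1)]) (auto simp: right_translation_def)
  also have "\<dots> = (\<Sum>y\<in>carrier G. (if y = vs ! u \<otimes> g then 1 else 0) * F y i)"
    by (rule sum_nth_distinct[OF vs])
  also have "\<dots> = (\<Sum>y\<in>carrier G. if y = vs ! u \<otimes> g then F y i else 0)" by (intro sum.cong) auto
  also have "\<dots> = F (vs ! u \<otimes> g) i" using xu g vs(2) List.finite_set[of vs] by (simp add: sum.delta)
  finally show ?thesis .
qed

lemma right_translation_hom:
  assumes vs: "distinct vs" "set vs = carrier G"
  shows "right_translation vs \<in> hom G (GL_cplx (length vs))"
  unfolding hom_GL_iff
proof (intro conjI ballI)
  have x: "vs ! u \<in> carrier G" if "u < length vs" for u using nth_mem[OF that] vs(2) by simp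
  fix g h assume g: "g \<in> carrier G" and h: "h \<in> carrier G"
  show "right_translation vs (g \<otimes> h) = right_translation vs g * right_translation vs h"
  proof (rule eq_matI)
    fix u i assume "u < dim_row (right_translation vs g * right_translation vs h)"
      "i < dim_col (right_translation vs g * right_translation vs h)"
    then have ui: "u < length vs" "i < length vs" by (auto simp: right_translation_def)
    have "(right_translation vs g * right_translation vs h) $$ (u, i) =
        (if vs ! i = vs ! u \<otimes> g \<otimes> h then 1 else 0)"
      by (rule right_translation_mult[OF vs g, where F = "\<lambda>x i. if vs ! i = x \<otimes> h then 1 else 0"])
        (use ui in \<open>auto simp: right_translation_def\<close>)
    then show "right_translation vs (g \<otimes> h) $$ (u, i) =
        (right_translation vs g * right_translation vs h) $$ (u, i)"
      using ui g h x[of u] by (simp add: right_translation_def m_assoc)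
  qed (auto simp: right_translation_def)
next
  have x: "vs ! u \<in> carrier G" if "u < length vs" for u using nth_mem[OF that] vs(2) by simp
  show "right_translation vs \<one> = 1\<^sub>m (length vs)"
    using x by (intro eq_matI) (auto simp: right_translation_def nth_eq_iff_index_eq[OF vs(1)])
qed (auto simp: right_translation_def)

end

section \<open>Representatives of all irreducible characters and the projection they define\<close>

text \<open>One representation for each irreducible character: \<open>trace_inj\<close> excludes
  repetitions, \<open>complete\<close> excludes gaps. Representations are compared through their
  traces only. Finiteness of the group is contained in \<open>set_vs\<close>.\<close>

locale irrep_transversal = group G for G :: "('a, 'b) monoid_scheme" (structure) +
  fixes J :: "'j set" and d :: "'j \<Rightarrow> nat" and \<sigma> :: "'j \<Rightarrow> 'a \<Rightarrow> complex mat" and vs :: "'a list"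
  assumes finite_J: "finite J"
    and irrep: "j \<in> J \<Longrightarrow> irreducible_rep G (d j) (\<sigma> j)"
    and trace_inj: "i \<in> J \<Longrightarrow> j \<in> J \<Longrightarrow> (\<And>g. g \<in> carrier G \<Longrightarrow> mat_trace (\<sigma> i g) = mat_trace (\<sigma> j g)) \<Longrightarrow> i = j"
    and complete: "irreducible_rep G k \<tau> \<Longrightarrow> \<exists>j\<in>J. \<forall>g\<in>carrier G. mat_trace (\<tau> g) = mat_trace (\<sigma> j g)"
    and distinct_vs: "distinct vs" and set_vs: "set vs = carrier G"
begin

text \<open>Classically the character of the regular representation, equal to the group order at
  \<open>\<one>\<close> and zero elsewhere. These values are not presupposed; only the expansion in
  irreducible characters is used.\<close>

definition regular_character :: "'a \<Rightarrow> complex" where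
  "regular_character g = (\<Sum>j\<in>J. of_nat (d j) * mat_trace (\<sigma> j g))"

lemma card_carrier: "card (carrier G) = length vs"
  using distinct_card[OF distinct_vs] unfolding set_vs .

lemma nth_vs_carrier [simp]: "u < length vs \<Longrightarrow> vs ! u \<in> carrier G"
  unfolding set_vs[symmetric] by (rule nth_mem)

lemma length_vs_pos: "length vs > 0"
proof -
  have "\<one> \<in> set vs" unfolding set_vs by (rule one_closed)
  then show ?thesis by (rule length_pos_if_in_set)
qed

lemma regular_character_conj:
  "g \<in> carrier G \<Longrightarrow> h \<in> carrier G \<Longrightarrow> regular_character (h \<otimes> g \<otimes> inv h) = regular_character g"
  unfolding regular_character_def using mat_trace_rep_conj[OF irrep] by (intro sum.cong) metis+

text \<open>By \<open>coefficient_eigenfunction\<close> for the class function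
  \<open>\<lambda>g. regular_character (inv g)\<close>, the coefficients of \<tau> are
  eigenfunctions. In the eigenvalue only the representative \<open>i\<close> with the character of
  \<tau> survives, and its degree \<open>d i = k\<close> cancels the division by
  \<open>k\<close>.\<close>

lemma regular_character_reproduces:
  assumes \<tau>: "irreducible_rep G k \<tau>" and ab: "a < k" "b < k" and x: "x \<in> carrier G"
  shows "(\<Sum>y\<in>carrier G. regular_character (x \<otimes> inv y) * \<tau> y $$ (a, b)) =
    of_nat (length vs) * \<tau> x $$ (a, b)"
proof -
  obtain i where i: "i \<in> J" "\<And>g. g \<in> carrier G \<Longrightarrow> mat_trace (\<tau> g) = mat_trace (\<sigma> i g)"
    using complete[OF \<tau>] by blast
  have di: "of_nat (d i) = (of_nat k :: complex)"
    using i(2)[of \<one>] mat_trace_rep_one[OF \<tau>] mat_trace_rep_one[OF irrep[OF i(1)]] by simp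
  have "(\<Sum>g\<in>carrier G. regular_character (inv g) * mat_trace (\<tau> g)) =
      (\<Sum>j\<in>J. of_nat (d j) * (\<Sum>g\<in>carrier G. mat_trace (\<tau> g) * mat_trace (\<sigma> j (inv g))))"
    unfolding regular_character_def sum_distrib_left sum_distrib_right
    by (subst sum.swap) (simp add: mult_ac)
  also have "\<dots> = (\<Sum>j\<in>J. if j = i then of_nat k * of_nat (length vs) else 0)"
  proof (rule sum.cong)
    fix j assume j: "j \<in> J"
    have "(\<forall>g\<in>carrier G. mat_trace (\<tau> g) = mat_trace (\<sigma> j g)) \<longleftrightarrow> j = i"
      using trace_inj[OF j i(1)] i(2) by metis
    then show "of_nat (d j) * (\<Sum>g\<in>carrier G. mat_trace (\<tau> g) * mat_trace (\<sigma> j (inv g))) =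
        (if j = i then of_nat k * of_nat (length vs) else 0)"
      using di by (simp add: character_inner_product[OF \<tau> irrep[OF j]] card_carrier)
  qed simp
  also have "\<dots> = of_nat k * of_nat (length vs)" using finite_J i(1) by simp
  finally have tr: "(\<Sum>g\<in>carrier G. regular_character (inv g) * mat_trace (\<tau> g)) =
      of_nat k * of_nat (length vs)" .
  have cl: "regular_character (inv (h \<otimes> g \<otimes> inv h)) = regular_character (inv g)"
    if "g \<in> carrier G" "h \<in> carrier G" for g h
    using regular_character_conj[of "inv g" h] that by (simp add: inv_mult_group m_assoc)
  have "(\<Sum>y\<in>carrier G. regular_character (x \<otimes> inv y) * \<tau> y $$ (a, b)) =
      (\<Sum>y\<in>carrier G. regular_character (inv (y \<otimes> inv x)) * \<tau> y $$ (a, b))"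
    using x by (intro sum.cong) (auto simp: inv_mult_group)
  also have "\<dots> = of_nat k * of_nat (length vs) / of_nat k * \<tau> x $$ (a, b)"
    using coefficient_eigenfunction[OF \<tau>, of "\<lambda>g. regular_character (inv g)", OF cl ab x] tr by simp
  finally show ?thesis using irreducible_repD(1)[OF \<tau>] by simp
qed

text \<open>Given by its kernel, so that commutation with translations can be read off. Its
  factorisation into coefficient matrices, from which idempotence follows, comes later.\<close>

definition coeff_proj :: "complex mat" where
  "coeff_proj = mat (length vs) (length vs)
     (\<lambda>(u, v). regular_character (vs ! u \<otimes> inv (vs ! v)) / of_nat (length vs))"

lemma coeff_proj_carrier [simp]: "coeff_proj \<in> carrier_mat (length vs) (length vs)"
  by (simp add: coeff_proj_def)

lemma dim_coeff_proj [simp]: "dim_row coeff_proj = length vs" "dim_col coeff_proj = length vs"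
  by (simp_all add: coeff_proj_def)

lemma coeff_proj_mult_entry:
  assumes M: "M \<in> carrier_mat (length vs) k" "\<And>v i. v < length vs \<Longrightarrow> i < k \<Longrightarrow> M $$ (v, i) = F (vs ! v) i"
    and ui: "u < length vs" "i < k"
  shows "(coeff_proj * M) $$ (u, i) =
    (\<Sum>y\<in>carrier G. regular_character (vs ! u \<otimes> inv y) * F y i) / of_nat (length vs)"
proof -
  have "(coeff_proj * M) $$ (u, i) =
      (\<Sum>v<length vs. regular_character (vs ! u \<otimes> inv (vs ! v)) / of_nat (length vs) * F (vs ! v) i)"
    using M ui by (subst mat_mult_entry[OF coeff_proj_carrier M(1)]) (auto simp: coeff_proj_def)
  also have "\<dots> = (\<Sum>y\<in>carrier G. regular_character (vs ! u \<otimes> inv y) / of_nat (length vs) * F y i)"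
    by (rule sum_nth_distinct[OF distinct_vs set_vs])
  finally show ?thesis by (simp add: sum_divide_distrib)
qed

text \<open>An intertwiner into the regular representation is determined by its row at \<open>\<one>\<close>; this
  exhibits its columns as combinations of matrix coefficients, which \<open>coeff_proj\<close> reproduces.\<close>
lemma coeff_proj_fixes_intertwiner:
  assumes \<tau>: "irreducible_rep G k \<tau>" and M: "M \<in> carrier_mat (length vs) k"
    and com: "\<And>g. g \<in> carrier G \<Longrightarrow> right_translation vs g * M = M * \<tau> g"
  shows "coeff_proj * M = M"
proof (rule eq_matI)
  note t = irreducible_repD[OF \<tau>]
  obtain u0 where u0: "u0 < length vs" "vs ! u0 = \<one>"
    using set_vs one_closed by (metis in_set_conv_nth)
  define F where "F x i = (\<Sum>a<k. M $$ (u0, a) * \<tau> x $$ (a, i))" for x i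
  \<comment> \<open>\<open>pos\<close> inverts the enumeration \<open>vs\<close>, so that the
    entries of \<open>M\<close> become a function of group elements, as
    \<open>right_translation_mult\<close> requires.\<close>
  define pos where "pos x = (THE v. v < length vs \<and> vs ! v = x)" for x
  have pos: "pos (vs ! v) = v" if "v < length vs" for v
    unfolding pos_def using that distinct_vs by (auto simp: nth_eq_iff_index_eq intro!: the_equality)
  have MF: "M $$ (v, i) = F (vs ! v) i" if v: "v < length vs" and i: "i < k" for v i
  proof -
    \<comment> \<open>Translation by \<open>vs ! v\<close> carries row \<open>v\<close> of
      \<open>M\<close> to the row of \<open>\<one>\<close>; comparing with
      \<open>M * \<tau> (vs ! v)\<close> expresses row \<open>v\<close> through row
      \<open>u0\<close>.\<close>
    have "(right_translation vs (vs ! v) * M) $$ (u0, i) = M $$ (pos (vs ! u0 \<otimes> vs ! v), i)"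
      by (rule right_translation_mult[OF distinct_vs set_vs _ M, where F = "\<lambda>x i. M $$ (pos x, i)"])
        (use v u0 i pos in auto)
    also have "\<dots> = M $$ (v, i)" using u0 v pos by simp
    finally show ?thesis using com[of "vs ! v"] v i t(2) u0 unfolding F_def
      by (simp add: mat_mult_entry[OF M _ u0(1) i] del: index_mult_mat(1))
  qed
  fix u i assume "u < dim_row M" "i < dim_col M"
  then have u: "u < length vs" and i: "i < k" using M by auto
  have "(coeff_proj * M) $$ (u, i) =
      (\<Sum>y\<in>carrier G. regular_character (vs ! u \<otimes> inv y) * F y i) / of_nat (length vs)"
    by (rule coeff_proj_mult_entry[OF M MF u i])
  also have "(\<Sum>y\<in>carrier G. regular_character (vs ! u \<otimes> inv y) * F y i) =
      (\<Sum>a<k. M $$ (u0, a) * (\<Sum>y\<in>carrier G. regular_character (vs ! u \<otimes> inv y) * \<tau> y $$ (a, i)))"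
    unfolding F_def sum_distrib_left by (subst sum.swap) (simp add: mult_ac)
  also have "\<dots> = (\<Sum>a<k. M $$ (u0, a) * (of_nat (length vs) * \<tau> (vs ! u) $$ (a, i)))"
    using u i by (intro sum.cong) (auto simp: regular_character_reproduces[OF \<tau>])
  also have "\<dots> = of_nat (length vs) * F (vs ! u) i"
    by (simp add: F_def sum_distrib_left mult_ac)
  finally show "(coeff_proj * M) $$ (u, i) = M $$ (u, i)" using MF[OF u i] length_vs_pos by auto
qed (use M in auto)

text \<open>The kernel depends on \<open>x \<otimes> inv y\<close> only, and \<open>x \<otimes> inv
  (y \<otimes> inv g) = (x \<otimes> g) \<otimes> inv y\<close>.\<close>

lemma coeff_proj_commutes_translation:
  assumes g: "g \<in> carrier G"
  shows "coeff_proj * right_translation vs g = right_translation vs g * coeff_proj"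
proof (rule eq_matI)
  fix u i assume "u < dim_row (right_translation vs g * coeff_proj)" "i < dim_col (right_translation vs g * coeff_proj)"
  then have u: "u < length vs" and i: "i < length vs" by (auto simp: right_translation_def coeff_proj_def)
  have R: "right_translation vs g \<in> carrier_mat (length vs) (length vs)" by (simp add: right_translation_def)
  have eq: "vs ! i = y \<otimes> g \<longleftrightarrow> y = vs ! i \<otimes> inv g" if "y \<in> carrier G" for y
    using that g i inv_solve_right[of y "vs ! i" g] by auto
  have "(coeff_proj * right_translation vs g) $$ (u, i) =
      (\<Sum>y\<in>carrier G. regular_character (vs ! u \<otimes> inv y) * (if vs ! i = y \<otimes> g then 1 else 0)) / of_nat (length vs)"
    by (rule coeff_proj_mult_entry[OF R _ u i]) (auto simp: right_translation_def)
  also have "(\<Sum>y\<in>carrier G. regular_character (vs ! u \<otimes> inv y) * (if vs ! i = y \<otimes> g then 1 else 0)) =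
      (\<Sum>y\<in>carrier G. if y = vs ! i \<otimes> inv g then regular_character (vs ! u \<otimes> inv y) else 0)"
    using eq by (intro sum.cong) auto
  also have "\<dots> = regular_character (vs ! u \<otimes> inv (vs ! i \<otimes> inv g))"
    using g i set_vs List.finite_set[of vs] by (simp add: sum.delta)
  also have "vs ! u \<otimes> inv (vs ! i \<otimes> inv g) = vs ! u \<otimes> g \<otimes> inv (vs ! i)"
    using g u i by (simp add: inv_mult_group m_assoc)
  also have "regular_character \<dots> / of_nat (length vs) = (right_translation vs g * coeff_proj) $$ (u, i)"
    by (rule right_translation_mult[OF distinct_vs set_vs g, symmetric,
          where F = "\<lambda>x i. regular_character (x \<otimes> inv (vs ! i)) / of_nat (length vs)"])
      (use u i in \<open>auto simp: coeff_proj_def\<close>)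
  finally show "(coeff_proj * right_translation vs g) $$ (u, i) = (right_translation vs g * coeff_proj) $$ (u, i)" .
qed (auto simp: right_translation_def coeff_proj_def)

text \<open>An idempotent with zero kernel is the identity. If the kernel is nonzero, it is
  translation invariant and contains an irreducible subrepresentation, embedded by
  \<open>B * A\<close>; this matrix is both fixed and annihilated by \<open>coeff_proj\<close>,
  contradicting its injectivity.\<close>

lemma coeff_proj_eq_one:
  assumes idem: "coeff_proj * coeff_proj = coeff_proj"
  shows "coeff_proj = 1\<^sub>m (length vs)"
proof (rule ccontr)
  let ?n = "length vs" and ?R = "right_translation vs"
  assume ne: "coeff_proj \<noteq> 1\<^sub>m ?n"
  have R: "?R g \<in> carrier_mat ?n ?n" for g by (simp add: right_translation_def)
  define K where "K = {v \<in> carrier_vec ?n. coeff_proj *\<^sub>v v = 0\<^sub>v ?n}"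
  have "VectorSpace.subspace class_ring K (module_vec TYPE(complex) ?n)"
    unfolding K_def by (rule kernel_subspace[OF coeff_proj_carrier])
  then obtain l B where B: "B \<in> carrier_mat ?n l" "inj_mat B" and KB: "K = {B *\<^sub>v x | x. x \<in> carrier_vec l}"
    by (rule subspace_basis_mat)
  have BK: "B *\<^sub>v x \<in> K" if "x \<in> carrier_vec l" for x using that unfolding KB by auto
  have EB: "coeff_proj * B = 0\<^sub>m ?n l"
  proof (rule eq_matI_mult_vec[of _ ?n l])
    fix v :: "complex vec" assume v: "v \<in> carrier_vec l"
    then show "coeff_proj * B *\<^sub>v v = 0\<^sub>m ?n l *\<^sub>v v"
      using BK[OF v] assoc_mult_mat_vec[OF coeff_proj_carrier B(1) v] by (auto simp: K_def)
  qed (use mult_carrier_mat[OF coeff_proj_carrier B(1)] in auto)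
  have "l > 0"
  proof (rule ccontr)
    assume "\<not> l > 0"
    then have l: "l = 0" by simp
    have K0: "K \<subseteq> {0\<^sub>v ?n}" unfolding KB using B(1) l
      by (auto intro!: eq_vecI simp: scalar_prod_def)
    have "coeff_proj = 1\<^sub>m ?n"
    proof (rule eq_matI_mult_vec[OF coeff_proj_carrier])
      fix v :: "complex vec" assume v: "v \<in> carrier_vec ?n"
      have Ev: "coeff_proj *\<^sub>v v \<in> carrier_vec ?n" using coeff_proj_carrier v by (rule mult_mat_vec_carrier)
      \<comment> \<open>Idempotence puts the difference of \<open>coeff_proj *\<^sub>v v\<close> and
        \<open>v\<close> into the kernel, which is zero here.\<close>
      have "coeff_proj *\<^sub>v (coeff_proj *\<^sub>v v) = coeff_proj *\<^sub>v v"
        using assoc_mult_mat_vec[OF coeff_proj_carrier coeff_proj_carrier v] idem by simp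
      then have "coeff_proj *\<^sub>v (coeff_proj *\<^sub>v v - v) = 0\<^sub>v ?n"
        using mult_minus_distrib_mat_vec[OF coeff_proj_carrier Ev v] Ev by simp
      then have "coeff_proj *\<^sub>v v - v \<in> K" unfolding K_def using Ev v by auto
      then have e: "coeff_proj *\<^sub>v v - v = 0\<^sub>v ?n" using K0 by auto
      show "coeff_proj *\<^sub>v v = 1\<^sub>m ?n *\<^sub>v v"
      proof (rule eq_vecI)
        fix i assume "i < dim_vec (1\<^sub>m ?n *\<^sub>v v)"
        then have i: "i < ?n" by simp
        have "(coeff_proj *\<^sub>v v - v) $ i = 0" using e i by simp
        then have "(coeff_proj *\<^sub>v v) $ i = v $ i" using Ev v i by (metis carrier_vecD index_minus_vec(1) right_minus_eq)
        then show "(coeff_proj *\<^sub>v v) $ i = (1\<^sub>m ?n *\<^sub>v v) $ i" using v by simp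
      qed (use Ev in auto)
    qed simp
    then show False using ne by simp
  qed
  have "\<exists>y\<in>carrier_vec l. B *\<^sub>v y = ?R g *\<^sub>v (B *\<^sub>v x)" if g: "g \<in> carrier G" and x: "x \<in> carrier_vec l" for g x
  proof -
    have Bx: "B *\<^sub>v x \<in> carrier_vec ?n" "coeff_proj *\<^sub>v (B *\<^sub>v x) = 0\<^sub>v ?n" using BK[OF x] unfolding K_def by auto
    have "coeff_proj *\<^sub>v (?R g *\<^sub>v (B *\<^sub>v x)) = ?R g *\<^sub>v (coeff_proj *\<^sub>v (B *\<^sub>v x))"
      using assoc_mult_mat_vec[OF coeff_proj_carrier R[of g] Bx(1)] assoc_mult_mat_vec[OF R[of g] coeff_proj_carrier Bx(1)]
        coeff_proj_commutes_translation[OF g] by simp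
    also have "\<dots> = 0\<^sub>v ?n" unfolding Bx(2) using R[of g] by (intro eq_vecI) auto
    finally have "?R g *\<^sub>v (B *\<^sub>v x) \<in> K"
      unfolding K_def using mult_mat_vec_carrier[OF R Bx(1)] by simp
    then show ?thesis unfolding KB by auto
  qed
  from restrict_rep[OF right_translation_hom[OF distinct_vs set_vs] B this]
  obtain \<rho> where \<rho>: "\<rho> \<in> hom G (GL_cplx l)" "\<And>g. g \<in> carrier G \<Longrightarrow> ?R g * B = B * \<rho> g" by metis
  obtain k \<tau> A where \<tau>: "irreducible_rep G k \<tau>" and A: "A \<in> carrier_mat l k" "inj_mat A"
    and com: "\<And>g. g \<in> carrier G \<Longrightarrow> \<rho> g * A = A * \<tau> g"
    using irreducible_subrep_exists[OF \<open>l > 0\<close> \<rho>(1)] by blast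
  have "?R g * (B * A) = B * A * \<tau> g" if g: "g \<in> carrier G" for g
  proof -
    have c: "\<rho> g \<in> carrier_mat l l" "\<tau> g \<in> carrier_mat k k"
      using \<rho>(1)[unfolded hom_GL_iff] irreducible_repD(2)[OF \<tau>] g by auto
    then show ?thesis
      using assoc_mult_mat[OF R[of g] B(1) A(1)] assoc_mult_mat[OF B(1) c(1) A(1)]
        assoc_mult_mat[OF B(1) A(1) c(2)] \<rho>(2)[OF g] com[OF g] by simp
  qed
  then have "coeff_proj * (B * A) = B * A" using B(1) A(1) by (intro coeff_proj_fixes_intertwiner[OF \<tau>]) auto
  moreover have "coeff_proj * (B * A) = 0\<^sub>m ?n k"
    using assoc_mult_mat[OF coeff_proj_carrier B(1) A(1)] EB A(1) by simp
  ultimately have BA: "B * A = 0\<^sub>m ?n k" by simp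
  have k: "k > 0" using irreducible_repD(1)[OF \<tau>] .
  have "B * A *\<^sub>v unit_vec k 0 = 0\<^sub>v ?n" unfolding BA by auto
  then have "unit_vec k 0 = (0\<^sub>v k :: complex vec)"
    using inj_mat_mult[OF B(2,1) A(2,1)] B(1) A(1) unfolding inj_mat_def by auto
  then show False using k by simp
qed

end

section \<open>Spectra of normal mixed Cayley graphs\<close>

lemma sum_single_mset_const: "finite A \<Longrightarrow> (\<Sum>x\<in>A. {#c#}) = replicate_mset (card A) c"
  by (induction A rule: finite_induct) auto

lemma mset_map_distinct: "distinct xs \<Longrightarrow> mset (map f xs) = (\<Sum>x\<in>set xs. {#f x#})"
  by (induction xs) auto

lemma proots_prod_linear_factors: "proots (\<Prod>a\<leftarrow>as. [:- a, 1:]) = mset (as :: 'a::idom list)"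
proof (induction as)
  case (Cons a as)
  have "proots ([:- a, 1:] * (\<Prod>a\<leftarrow>as. [:- a, 1:])) = proots [:- a, 1:] + proots (\<Prod>a\<leftarrow>as. [:- a, 1:])"
    by (rule proots_mult) (auto simp: prod_list_zero_iff)
  then show ?case using Cons by (simp del: mult_pCons_left)
qed simp

lemma sum_over_Sigma:
  assumes "finite A" "\<And>x. x \<in> A \<Longrightarrow> finite (B x)"
  shows "sum F (Sigma A B) = (\<Sum>x\<in>A. \<Sum>y\<in>B x. F (x, y))"
  using assms by (subst sum.Sigma) auto

context irrep_transversal
begin

text \<open>\<open>Q * P = 1\<close> is Schur orthogonality and \<open>P * Q\<close> is
  \<open>coeff_proj\<close>. Both products being identities forces \<open>P\<close> to be square, so
  the degrees satisfy: the sum of \<open>(d j)\<^sup>2\<close> is the group order.\<close>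

lemma coefficient_matrices:
  obtains ts P Q where
    "distinct ts" "set ts = (SIGMA j:J. {..<d j} \<times> {..<d j})" "length ts = length vs"
    "P = mat (length vs) (length vs) (\<lambda>(u, t). case ts ! t of (j, a, b) \<Rightarrow> \<sigma> j (vs ! u) $$ (a, b))"
    "Q \<in> carrier_mat (length vs) (length vs)" "P * Q = 1\<^sub>m (length vs)" "Q * P = 1\<^sub>m (length vs)"
proof -
  let ?n = "length vs" and ?I = "SIGMA j:J. {..<d j} \<times> {..<d j}"
  have fin: "finite ?I" using finite_J by auto
  then obtain ts where ts: "distinct ts" "set ts = ?I" using finite_distinct_list by metis
  let ?N = "length ts"
  define p where "p t x = (case t of (j, a, b) \<Rightarrow> \<sigma> j x $$ (a, b))" for t :: "'j \<times> nat \<times> nat" and x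
  \<comment> \<open>The dual system to \<open>p\<close>: the transposed index pair
    \<open>(b, a)\<close> and the factor \<open>d j / n\<close> normalise the orthogonality
    relations to Kronecker deltas.\<close>
  define q where "q t x = (case t of (j, a, b) \<Rightarrow> of_nat (d j) / of_nat ?n * \<sigma> j (inv x) $$ (b, a))"
    for t :: "'j \<times> nat \<times> nat" and x
  define P where "P = mat ?n ?N (\<lambda>(u, t). p (ts ! t) (vs ! u))"
  define Q where "Q = mat ?N ?n (\<lambda>(t, u). q (ts ! t) (vs ! u))"
  have P: "P \<in> carrier_mat ?n ?N" and Q: "Q \<in> carrier_mat ?N ?n" by (simp_all add: P_def Q_def)
  have QP: "Q * P = 1\<^sub>m ?N"
  proof (rule eq_matI)
    fix s t assume "s < dim_row (1\<^sub>m ?N)" "t < dim_col (1\<^sub>m ?N :: complex mat)"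
    then have st: "s < ?N" "t < ?N" by auto
    obtain j a b where s: "ts ! s = (j, a, b)" using prod_cases3 by metis
    obtain i a' b' where t: "ts ! t = (i, a', b')" using prod_cases3 by metis
    have idx: "j \<in> J" "a < d j" "b < d j" "i \<in> J" "a' < d i" "b' < d i"
      using nth_mem[OF st(1)] nth_mem[OF st(2)] ts(2) s t by auto
    have "(Q * P) $$ (s, t) = (\<Sum>u<?n. q (ts ! s) (vs ! u) * p (ts ! t) (vs ! u))"
      using st by (subst mat_mult_entry[OF Q P]) (auto simp: P_def Q_def)
    also have "\<dots> = (\<Sum>x\<in>carrier G. q (ts ! s) x * p (ts ! t) x)"
      by (rule sum_nth_distinct[OF distinct_vs set_vs])
    also have "\<dots> = of_nat (d j) / of_nat ?n * (\<Sum>x\<in>carrier G. \<sigma> i x $$ (a', b') * \<sigma> j (inv x) $$ (b, a))"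
      unfolding s t p_def q_def by (simp add: sum_distrib_left mult_ac)
    also have "\<dots> = (if s = t then 1 else 0)"
    proof (cases "i = j")
      case True
      then show ?thesis
        using idx st s t nth_eq_iff_index_eq[OF ts(1) st] length_vs_pos
        by (auto simp: coefficient_orthogonality_same[OF irrep] card_carrier)
    next
      case False
      then obtain g where "g \<in> carrier G" "mat_trace (\<sigma> i g) \<noteq> mat_trace (\<sigma> j g)"
        using trace_inj idx by blast
      moreover have "s \<noteq> t" using False s t by auto
      ultimately show ?thesis
        using coefficient_orthogonality_distinct[OF irrep[OF idx(4)] irrep[OF idx(1)] _ _ idx(5,6,3,2)] by simp
    qed
    finally show "(Q * P) $$ (s, t) = 1\<^sub>m ?N $$ (s, t)" using st by simp
  qed (use P Q in auto)
  have PQ: "P * Q = coeff_proj"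
  proof (rule eq_matI)
    fix u v assume "u < dim_row coeff_proj" "v < dim_col coeff_proj"
    then have uv: "u < ?n" "v < ?n" by auto
    have "(P * Q) $$ (u, v) = (\<Sum>t<?N. p (ts ! t) (vs ! u) * q (ts ! t) (vs ! v))"
      using uv by (subst mat_mult_entry[OF P Q]) (auto simp: P_def Q_def)
    also have "\<dots> = (\<Sum>t\<in>?I. p t (vs ! u) * q t (vs ! v))"
      by (rule sum_nth_distinct[OF ts])
    also have "\<dots> = (\<Sum>j\<in>J. \<Sum>a<d j. \<Sum>b<d j. p (j, a, b) (vs ! u) * q (j, a, b) (vs ! v))"
      using finite_J by (simp add: sum_over_Sigma)
    also have "\<dots> = (\<Sum>j\<in>J. of_nat (d j) / of_nat ?n * mat_trace (\<sigma> j (vs ! u \<otimes> inv (vs ! v))))"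
    proof (rule sum.cong)
      fix j assume j: "j \<in> J"
      note s = irreducible_repD[OF irrep[OF j]]
      have "(\<Sum>a<d j. \<Sum>b<d j. p (j, a, b) (vs ! u) * q (j, a, b) (vs ! v)) = of_nat (d j) / of_nat ?n *
          (\<Sum>a<d j. \<Sum>b<d j. \<sigma> j (vs ! u) $$ (a, b) * \<sigma> j (inv (vs ! v)) $$ (b, a))"
        by (simp add: p_def q_def sum_distrib_left mult_ac)
      also have "(\<Sum>a<d j. \<Sum>b<d j. \<sigma> j (vs ! u) $$ (a, b) * \<sigma> j (inv (vs ! v)) $$ (b, a)) =
          mat_trace (\<sigma> j (vs ! u) * \<sigma> j (inv (vs ! v)))"
        using s(2)[of "vs ! u"] s(2)[of "inv (vs ! v)"] uv
        by (subst mat_trace_eq[of _ "d j"]) (auto simp: mat_mult_entry[of _ "d j" "d j" _ "d j"] simp del: index_mult_mat(1))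
      also have "\<sigma> j (vs ! u) * \<sigma> j (inv (vs ! v)) = \<sigma> j (vs ! u \<otimes> inv (vs ! v))"
        using s(3) uv by simp
      finally show "(\<Sum>a<d j. \<Sum>b<d j. p (j, a, b) (vs ! u) * q (j, a, b) (vs ! v)) =
          of_nat (d j) / of_nat ?n * mat_trace (\<sigma> j (vs ! u \<otimes> inv (vs ! v)))" .
    qed simp
    also have "\<dots> = coeff_proj $$ (u, v)"
      using uv by (simp add: coeff_proj_def regular_character_def sum_divide_distrib)
    finally show "(P * Q) $$ (u, v) = coeff_proj $$ (u, v)" .
  qed (use P Q in auto)
  \<comment> \<open>Idempotence follows from \<open>Q * P = 1\<close> by reassociating.\<close>
  have "coeff_proj * coeff_proj = P * (Q * P) * Q"
    using P Q PQ by (simp add: assoc_mult_mat[of _ ?n ?N _ ?n _ ?n] assoc_mult_mat[of _ ?N ?n _ ?N _ ?n]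
      assoc_mult_mat[of _ ?n ?N _ ?N _ ?n] flip: PQ)
  also have "\<dots> = coeff_proj" unfolding QP using P Q PQ by simp
  finally have PQ1: "P * Q = 1\<^sub>m ?n" unfolding PQ by (rule coeff_proj_eq_one)
  \<comment> \<open>Each of \<open>P\<close> and \<open>Q\<close> has a left inverse, so both are
    injective and the dimension bound applies in both directions.\<close>
  have "?N = ?n"
    using inj_mat_dim_le[OF inj_mat_left_inverse[OF Q P QP] P]
      inj_mat_dim_le[OF inj_mat_left_inverse[OF P Q PQ1] Q] by simp
  then show ?thesis using that[OF ts, of P Q] Q PQ1 QP by (simp add: P_def p_def)
qed

text \<open>The columns of \<open>P\<close> are eigenvectors, so \<open>P\<close> conjugates the
  matrix to the diagonal matrix \<open>D\<close>. The eigenvalue at \<open>(j, a, b)\<close> depends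
  on \<open>j\<close> only and is listed once for each of the \<open>(d j)\<^sup>2\<close> pairs;
  the multiset sum adds multiplicities of coinciding eigenvalues.\<close>

lemma class_function_spectrum:
  assumes f: "\<And>g h. g \<in> carrier G \<Longrightarrow> h \<in> carrier G \<Longrightarrow> f (h \<otimes> g \<otimes> inv h) = f g"
  shows "proots (char_poly (mat (length vs) (length vs) (\<lambda>(u, v). f (vs ! v \<otimes> inv (vs ! u))))) =
    (\<Sum>j\<in>J. replicate_mset ((d j)\<^sup>2) ((\<Sum>g\<in>carrier G. f g * mat_trace (\<sigma> j g)) / of_nat (d j)))"
    (is "proots (char_poly ?H) = _")
proof -
  let ?n = "length vs" and ?I = "SIGMA j:J. {..<d j} \<times> {..<d j}"
  define c where "c j = (\<Sum>g\<in>carrier G. f g * mat_trace (\<sigma> j g)) / of_nat (d j)" for j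
  obtain ts P Q where ts: "distinct ts" "set ts = ?I" "length ts = ?n"
    and P_def: "P = mat ?n ?n (\<lambda>(u, t). case ts ! t of (j, a, b) \<Rightarrow> \<sigma> j (vs ! u) $$ (a, b))"
    and Q: "Q \<in> carrier_mat ?n ?n" and PQ: "P * Q = 1\<^sub>m ?n" and QP: "Q * P = 1\<^sub>m ?n"
    by (rule coefficient_matrices)
  have P: "P \<in> carrier_mat ?n ?n" by (simp add: P_def)
  define D where "D = mat ?n ?n (\<lambda>(s, t). if s = t then c (fst (ts ! t)) else 0)"
  have D: "D \<in> carrier_mat ?n ?n" by (simp add: D_def)
  have H: "?H \<in> carrier_mat ?n ?n" by simp
  have HP: "?H * P = P * D"
  proof (rule eq_matI)
    fix u t assume "u < dim_row (P * D)" "t < dim_col (P * D)"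
    then have ut: "u < ?n" "t < ?n" using P D by auto
    obtain j a b where t: "ts ! t = (j, a, b)" using prod_cases3 by metis
    have idx: "j \<in> J" "a < d j" "b < d j" using nth_mem[of t ts] ts(2,3) t ut by auto
    have "(?H * P) $$ (u, t) = (\<Sum>v<?n. f (vs ! v \<otimes> inv (vs ! u)) * \<sigma> j (vs ! v) $$ (a, b))"
      using ut t by (subst mat_mult_entry[OF H P]) (auto simp: P_def)
    also have "\<dots> = (\<Sum>y\<in>carrier G. f (y \<otimes> inv (vs ! u)) * \<sigma> j y $$ (a, b))"
      by (rule sum_nth_distinct[OF distinct_vs set_vs])
    also have "\<dots> = c j * \<sigma> j (vs ! u) $$ (a, b)"
      using coefficient_eigenfunction[OF irrep[OF idx(1)], of f, OF f idx(2,3)] ut by (simp add: c_def)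
    also have "\<dots> = (\<Sum>s<?n. if s = t then c j * \<sigma> j (vs ! u) $$ (a, b) else 0)" using ut by simp
    also have "\<dots> = (\<Sum>s<?n. P $$ (u, s) * D $$ (s, t))"
      using ut t by (intro sum.cong) (auto simp: P_def D_def)
    also have "\<dots> = (P * D) $$ (u, t)" by (rule mat_mult_entry[OF P D ut, symmetric])
    finally show "(?H * P) $$ (u, t) = (P * D) $$ (u, t)" .
  qed (use P D in auto)
  have "?H = ?H * (P * Q)" unfolding PQ by (rule right_mult_one_mat[symmetric, OF H])
  also have "\<dots> = P * D * Q" using assoc_mult_mat[OF H P Q] HP by simp
  finally have "similar_mat ?H D"
    using P Q D PQ QP by (intro similar_matI[of _ _ P Q ?n]) auto
  then have "char_poly ?H = char_poly D" by (rule char_poly_similar)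
  also have "\<dots> = (\<Prod>a\<leftarrow>diag_mat D. [:- a, 1:])"
    by (rule char_poly_upper_triangular[OF D]) (auto simp: D_def)
  also have "diag_mat D = map (\<lambda>t. c (fst t)) ts"
    using ts(3) by (intro nth_equalityI) (auto simp: diag_mat_def D_def)
  finally have "proots (char_poly ?H) = mset (map (\<lambda>t. c (fst t)) ts)"
    by (simp only: proots_prod_linear_factors)
  also have "\<dots> = (\<Sum>t\<in>?I. {#c (fst t)#})"
    using mset_map_distinct[OF ts(1)] ts(2) by simp
  also have "\<dots> = (\<Sum>j\<in>J. \<Sum>t\<in>{..<d j} \<times> {..<d j}. {#c j#})"
    using finite_J by (subst sum_over_Sigma) auto
  also have "\<dots> = (\<Sum>j\<in>J. replicate_mset ((d j)\<^sup>2) (c j))"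
    by (simp add: sum_single_mset_const power2_eq_square)
  finally show ?thesis by (simp add: c_def)
qed

end

section \<open>The class function of a normal mixed Cayley graph\<close>

text \<open>Conjugacy classes are closed under conjugation; the converse direction conjugates back
  by \<open>inv h\<close>.\<close>

lemma (in group) normal_connection_set_conj_iff:
  assumes nS: "normal_connection_set G S"
    and g: "g \<in> carrier G" and h: "h \<in> carrier G"
  shows "h \<otimes> g \<otimes> inv h \<in> S \<longleftrightarrow> g \<in> S"
proof -
  obtain C where C: "C \<subseteq> conj_classes G" "S = \<Union>C" using nS unfolding normal_connection_set_def by blast
  have closed: "k \<otimes> s \<otimes> inv k \<in> S" if s: "s \<in> S" and k: "k \<in> carrier G" for s k
  proof -
    obtain K where K: "K \<in> C" "s \<in> K" using C s by blast
    then obtain x where x: "x \<in> carrier G"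
      and Kx: "K = {a \<otimes> x \<otimes> inv a | a. a \<in> carrier G}"
      using C(1) unfolding conj_classes_def orbits_def orbit_def by force
    obtain a where a: "a \<in> carrier G" "s = a \<otimes> x \<otimes> inv a" using K(2) Kx by blast
    then have "k \<otimes> s \<otimes> inv k = (k \<otimes> a) \<otimes> x \<otimes> inv (k \<otimes> a)"
      using k x by (simp add: inv_mult_group m_assoc)
    then have "k \<otimes> s \<otimes> inv k \<in> K" using k a(1) unfolding Kx by blast
    then show ?thesis using K(1) C(2) by blast
  qed
  have "inv h \<otimes> (h \<otimes> g \<otimes> inv h) \<otimes> inv (inv h) = inv h \<otimes> (h \<otimes> g)"
    using g h by (simp add: m_assoc)
  also have "\<dots> = g" using g h by (simp flip: m_assoc)
  finally show ?thesis using closed[of g h] closed[of "h \<otimes> g \<otimes> inv h" "inv h"] g h by auto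
qed

lemma (in group) inv_conj:
  assumes "a \<in> carrier G" "b \<in> carrier G"
  shows "inv (b \<otimes> a \<otimes> inv b) = b \<otimes> inv a \<otimes> inv b"
  using assms by (simp add: inv_mult_group m_assoc)

lemma omega6_eq: "omega6 = (1 + \<i> * of_real (sqrt 3)) / 2"
proof -
  have "omega6 = exp (\<i> * of_real (pi / 3))" by (simp add: omega6_def mult.commute)
  also have "\<dots> = cis (pi / 3)" by (simp add: cis_conv_exp)
  finally show ?thesis by (simp add: complex_eq_iff cos_60 sin_60)
qed

text \<open>From \<open>omega6\<^sup>2 = omega6 - 1\<close> the fifth power reduces to
  \<open>1 - omega6\<close>, the complex conjugate of \<open>omega6\<close>.\<close>

lemma omega6_pow5: "omega6 ^ 5 = (1 - \<i> * of_real (sqrt 3)) / 2"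
proof -
  have r: "(of_real (sqrt 3) :: complex)\<^sup>2 = 3" by (simp flip: of_real_power)
  have 2: "omega6\<^sup>2 = omega6 - 1"
    unfolding omega6_eq by (simp add: power2_eq_square field_simps) (simp add: r flip: power2_eq_square)
  have "omega6 ^ 5 = omega6\<^sup>2 * omega6\<^sup>2 * omega6" by (simp flip: power_add power_Suc2)
  also have "\<dots> = 1 - omega6" unfolding 2 using 2 by (simp add: algebra_simps power2_eq_square)
  finally show ?thesis by (simp add: omega6_eq field_simps)
qed

text \<open>On the carrier the three conditions exclude each other; they stand for an edge in both
  directions, a forward arc and a backward arc. The additive form lets sums against a character
  split into the parts of \<open>lam\<close> and \<open>mu\<close>.\<close>

definition hs_weight :: "('a, 'b) monoid_scheme \<Rightarrow> 'a set \<Rightarrow> 'a \<Rightarrow> complex" where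
  "hs_weight G S s =
     (if s \<in> S - sbar G S then 1 else 0) + (if s \<in> sbar G S then omega6 else 0) +
     (if inv\<^bsub>G\<^esub> s \<in> sbar G S then omega6 ^ 5 else 0)"

lemma (in group) hs_weight_conj:
  assumes S: "normal_connection_set G S" and a: "a \<in> carrier G" and b: "b \<in> carrier G"
  shows "hs_weight G S (b \<otimes> a \<otimes> inv b) = hs_weight G S a"
proof -
  have 1: "inv (b \<otimes> a \<otimes> inv b) = b \<otimes> inv a \<otimes> inv b"
    by (rule inv_conj[OF a b])
  have 2: "inv (b \<otimes> inv a \<otimes> inv b) = b \<otimes> a \<otimes> inv b"
    using inv_conj[OF inv_closed[OF a] b] a by (simp only: inv_inv)
  note iff = normal_connection_set_conj_iff[OF S a b]
    normal_connection_set_conj_iff[OF S inv_closed[OF a] b]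
  show ?thesis
    by (simp only: hs_weight_def sbar_def mem_Collect_eq Diff_iff 1 2 iff inv_inv[OF a])
qed

text \<open>The arc from \<open>x\<close> to \<open>y\<close> is governed by
  \<open>y \<otimes> inv x\<close> and the reverse arc by its inverse, so the cases of
  \<open>hs_entry\<close> match those of the weight.\<close>

lemma (in group) hs_entry_cayley:
  assumes "x \<in> carrier G" "y \<in> carrier G"
  shows "hs_entry (cayley_graph G S) x y = hs_weight G S (y \<otimes> inv x)"
proof -
  have "inv (y \<otimes> inv x) = x \<otimes> inv y" "inv (x \<otimes> inv y) = y \<otimes> inv x"
    using assms by (simp_all add: inv_mult_group)
  then show ?thesis using assms
    by (auto simp: hs_entry_def hs_weight_def cayley_graph_def sbar_def omega6_eq[symmetric] omega6_pow5[symmetric])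
qed

lemma (in group) sum_hs_weight:
  assumes fin: "finite (carrier G)" and S: "S \<subseteq> carrier G"
  shows "(\<Sum>g\<in>carrier G. hs_weight G S g * \<phi> g) =
    (\<Sum>s\<in>S - sbar G S. \<phi> s) + (\<Sum>s\<in>sbar G S. omega6 * \<phi> s + omega6 ^ 5 * \<phi> (inv s))"
proof -
  have sub: "sbar G S \<subseteq> carrier G" using S by (auto simp: sbar_def)
  have ind: "(\<Sum>g\<in>carrier G. if g \<in> A then F g else 0) = sum F A" if "A \<subseteq> carrier G" for A and F :: "'a \<Rightarrow> complex"
    using sum.inter_restrict[OF fin, of F A] that by (simp add: Int_absorb1)
  have "(\<Sum>g\<in>carrier G. hs_weight G S g * \<phi> g) =
      (\<Sum>g\<in>carrier G. if g \<in> S - sbar G S then \<phi> g else 0) +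
      (\<Sum>g\<in>carrier G. if g \<in> sbar G S then omega6 * \<phi> g else 0) +
      (\<Sum>g\<in>carrier G. if inv g \<in> sbar G S then omega6 ^ 5 * \<phi> (inv (inv g)) else 0)"
    unfolding sum.distrib[symmetric] by (intro sum.cong) (auto simp: hs_weight_def algebra_simps)
  also have "(\<Sum>g\<in>carrier G. if inv g \<in> sbar G S then omega6 ^ 5 * \<phi> (inv (inv g)) else 0) =
      (\<Sum>g\<in>carrier G. if g \<in> sbar G S then omega6 ^ 5 * \<phi> (inv g) else 0)"
    by (rule sum_inv_reindex)
  finally show ?thesis using ind[OF sub] ind[of "S - sbar G S" \<phi>] S
    by (simp only: sum.distrib add.assoc Diff_subset[THEN subset_trans])
qed

theorem lemma2p5:
  fixes G :: "('a, 'b) monoid_scheme"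
    and S :: "'a set"
    and h :: nat
    and \<chi> :: "nat \<Rightarrow> 'a \<Rightarrow> complex"
    and d :: "nat \<Rightarrow> nat"
    and lam mu \<gamma> :: "nat \<Rightarrow> complex"
    and vs :: "'a list"
  assumes "group G" and "finite (carrier G)"
    and "S \<subseteq> carrier G" and "\<one>\<^bsub>G\<^esub> \<notin> S"
    and "normal_connection_set G S"
    and "bij_betw \<chi> {1..h} (irr_chars G)"
    and "\<And>j. j \<in> {1..h} \<Longrightarrow> of_nat (d j) = \<chi> j \<one>\<^bsub>G\<^esub>"
    and "\<And>j. j \<in> {1..h} \<Longrightarrow>
           lam j = 1 / \<chi> j \<one>\<^bsub>G\<^esub> * (\<Sum>s\<in>S - sbar G S. \<chi> j s)"
    and "\<And>j. j \<in> {1..h} \<Longrightarrow>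
           mu j = 1 / \<chi> j \<one>\<^bsub>G\<^esub> *
             (\<Sum>s\<in>sbar G S. omega6 * \<chi> j s + omega6 ^ 5 * \<chi> j (inv\<^bsub>G\<^esub> s))"
    and "\<And>j. j \<in> {1..h} \<Longrightarrow> \<gamma> j = lam j + mu j"
    and "distinct vs" and "set vs = pverts (cayley_graph G S)"
  shows "hs_spectrum (cayley_graph G S) vs = (\<Sum>j\<in>{1..h}. replicate_mset ((d j)\<^sup>2) (\<gamma> j))"
proof -
  interpret group G by fact
  have vs: "set vs = carrier G" using assms(12) by (simp add: cayley_graph_def)
  have "\<exists>\<rho>. irreducible_rep G (d j) \<rho> \<and> \<chi> j = restrict (\<lambda>g. mat_trace (\<rho> g)) (carrier G)"
    if j: "j \<in> {1..h}" for j
  proof -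
    have "\<chi> j \<in> irr_chars G" using assms(6) j by (auto simp: bij_betw_def)
    then obtain n \<rho> where \<rho>: "irreducible_rep G n \<rho>"
      and \<chi>: "\<chi> j = restrict (\<lambda>g. mat_trace (\<rho> g)) (carrier G)"
      unfolding irr_chars_def by auto
    \<comment> \<open>The value of the character at \<open>\<one>\<close> determines the degree of
      the representation, so \<open>d j\<close> is that degree.\<close>
    have "of_nat (d j) = (of_nat n :: complex)"
      using assms(7)[OF j] mat_trace_rep_one[OF \<rho>] \<chi> by simp
    then have "d j = n" by simp
    then show ?thesis using \<rho> \<chi> by blast
  qed
  then obtain \<sigma> where \<sigma>: "\<And>j. j \<in> {1..h} \<Longrightarrow> irreducible_rep G (d j) (\<sigma> j)"
    and \<chi>: "\<And>j. j \<in> {1..h} \<Longrightarrow> \<chi> j = restrict (\<lambda>g. mat_trace (\<sigma> j g)) (carrier G)" by metis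
  \<comment> \<open>Injectivity of \<chi> on the index set gives \<open>trace_inj\<close> and
    surjectivity gives \<open>complete\<close>. Traces that agree on the carrier give equal
    functions because characters are restricted to it.\<close>
  have "irrep_transversal G {1..h} d \<sigma> vs"
  proof unfold_locales
    fix i j assume ij: "i \<in> {1..h}" "j \<in> {1..h}"
      and "\<And>g. g \<in> carrier G \<Longrightarrow> mat_trace (\<sigma> i g) = mat_trace (\<sigma> j g)"
    then have "\<chi> i = \<chi> j" unfolding \<chi>[OF ij(1)] \<chi>[OF ij(2)] by (intro restrict_ext) auto
    then show "i = j" using assms(6) ij by (auto simp: bij_betw_def dest: inj_onD)
  next
    fix k \<tau> assume "irreducible_rep G k \<tau>"
    then have "restrict (\<lambda>g. mat_trace (\<tau> g)) (carrier G) \<in> irr_chars G"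
      unfolding irr_chars_def by blast
    then obtain j where j: "j \<in> {1..h}" "\<chi> j = restrict (\<lambda>g. mat_trace (\<tau> g)) (carrier G)"
      using assms(6) by (metis bij_betw_imp_surj_on imageE)
    then have "mat_trace (\<tau> g) = mat_trace (\<sigma> j g)" if "g \<in> carrier G" for g
      using that \<chi>[OF j(1)] by (metis restrict_apply')
    then show "\<exists>j\<in>{1..h}. \<forall>g\<in>carrier G. mat_trace (\<tau> g) = mat_trace (\<sigma> j g)" using j(1) by blast
  next
    show "finite {1..h}" by simp
    show "irreducible_rep G (d j) (\<sigma> j)" if "j \<in> {1..h}" for j by (rule \<sigma>[OF that])
  qed (fact assms(11) vs)+
  then interpret irrep_transversal G "{1..h}" d \<sigma> vs .
  note conj = hs_weight_conj[OF assms(5)]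
  have "hs_matrix (cayley_graph G S) vs =
      mat (length vs) (length vs) (\<lambda>(u, v). hs_weight G S (vs ! v \<otimes>\<^bsub>G\<^esub> inv\<^bsub>G\<^esub> (vs ! u)))"
    by (intro eq_matI) (auto simp: hs_matrix_def hs_entry_cayley)
  then have "hs_spectrum (cayley_graph G S) vs =
      (\<Sum>j\<in>{1..h}. replicate_mset ((d j)\<^sup>2)
        ((\<Sum>g\<in>carrier G. hs_weight G S g * mat_trace (\<sigma> j g)) / of_nat (d j)))"
    using class_function_spectrum[of "hs_weight G S", OF conj] by (simp add: hs_spectrum_def)
  also have "\<dots> = (\<Sum>j\<in>{1..h}. replicate_mset ((d j)\<^sup>2) (\<gamma> j))"
  proof (rule sum.cong)
    fix j assume j: "j \<in> {1..h}"
    have "(\<Sum>g\<in>carrier G. hs_weight G S g * mat_trace (\<sigma> j g)) =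
        (\<Sum>g\<in>carrier G. hs_weight G S g * \<chi> j g)"
      by (intro sum.cong) (auto simp: \<chi>[OF j])
    then have "(\<Sum>g\<in>carrier G. hs_weight G S g * mat_trace (\<sigma> j g)) / of_nat (d j) = \<gamma> j"
      unfolding sum_hs_weight[OF assms(2,3)]
      using assms(7)[OF j] assms(8)[OF j] assms(9)[OF j] assms(10)[OF j] by (simp add: add_divide_distrib)
    then show "replicate_mset ((d j)\<^sup>2)
        ((\<Sum>g\<in>carrier G. hs_weight G S g * mat_trace (\<sigma> j g)) / of_nat (d j)) =
        replicate_mset ((d j)\<^sup>2) (\<gamma> j)" by simp
  qed simp
  finally show ?thesis .
qed

end
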